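(* Let $G$ be a locally finite connected graph that is planar, has exactly one end, and is hyperbolic. Let $\Gamma$ be any group of automorphisms of $G$ acting transitively on the vertex set $VG$. Then no hyperbolic boundary point of $G$ is fixed by all elements of $\Gamma$.
   Context: Graphs are regarded as metric $1$-complexes in which every edge is an isometric copy of $[0,1]$; $d$ denotes the graph distance. A geodesic is a path between vertices $x,y$ of length $d(x,y)$. A graph $G$ is $\delta$-hyperbolic ($\delta\ge 0$) if it is locally finite and for every three vertices $x,y,z$, every choice of geodesics $\pi_{xy},\pi_{yz},\pi_{zx}$ joining them in pairs, and every point $\xi$ (vertex or inner point of an edge) on $\pi_{xy}$, there is a point on $\pi_{yz}\cup\pi_{zx}$ at distance at most $\delta$ from $\xi$; $G$ is hyperbolic if it is $\delta$-hyperbolic for some $\delta$. A ray is a one-way infinite path; two rays are equivalent if for every finite vertex set $S$ they eventually lie in the same component of $G-S$; the equivalence classes are the ends of $G$. A ray is geodetic if every finite subpath is a geodesic. Two geodetic rays $x_1x_2\ldots$ and $\pi'$ are equivalent if there is $M$ with $\liminf_{n\to\infty} d(x_{n},\pi')\le M$; a hyperbolic boundary point is an equivalence class of geodetic rays. A graph is planar if it admits an embedding as a $1$-complex into the Euclidean plane. Automorphisms act on the right; an automorphism fixes a boundary point $\omega$ if it maps geodetic rays in the class $\omega$ to geodetic rays in the class $\omega$. *)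

theory Defs
  imports "HOL-Analysis.Analysis" "HOL-Algebra.Bij"
begin

section \<open>Simple graphs, paths, distance\<close>

text \<open>Graphs are undirected and simple; the vertex set may be infinite.\<close>

definition simple_graph :: "'a set \<Rightarrow> 'a set set \<Rightarrow> bool" where
  "simple_graph V E \<longleftrightarrow> (\<forall>e\<in>E. e \<subseteq> V \<and> card e = 2)"

definition locally_finite_graph :: "'a set \<Rightarrow> 'a set set \<Rightarrow> bool" where
  "locally_finite_graph V E \<longleftrightarrow> (\<forall>v\<in>V. finite {e\<in>E. v \<in> e})"

text \<open>A path is given by its list of vertices, so its length is \<open>length xs - 1\<close>. Taking
  \<open>A\<close> smaller than the vertex set gives the paths in the induced subgraph on \<open>A\<close>.\<close>

definition graph_path :: "'a set \<Rightarrow> 'a set set \<Rightarrow> 'a \<Rightarrow> 'a \<Rightarrow> 'a list \<Rightarrow> bool" where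
  "graph_path A E x y xs \<longleftrightarrow>
     xs \<noteq> [] \<and> hd xs = x \<and> last xs = y \<and> set xs \<subseteq> A \<and> distinct xs \<and>
     successively (\<lambda>u v. {u, v} \<in> E) xs"

definition connected_graph :: "'a set \<Rightarrow> 'a set set \<Rightarrow> bool" where
  "connected_graph V E \<longleftrightarrow> (\<forall>x\<in>V. \<forall>y\<in>V. \<exists>xs. graph_path V E x y xs)"

text \<open>Only meaningful for vertices in the same component.\<close>

definition graph_dist :: "'a set \<Rightarrow> 'a set set \<Rightarrow> 'a \<Rightarrow> 'a \<Rightarrow> nat" where
  "graph_dist V E x y = (LEAST n. \<exists>xs. graph_path V E x y xs \<and> length xs - 1 = n)"

definition geodesic :: "'a set \<Rightarrow> 'a set set \<Rightarrow> 'a \<Rightarrow> 'a \<Rightarrow> 'a list \<Rightarrow> bool" where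
  "geodesic V E x y xs \<longleftrightarrow> graph_path V E x y xs \<and> length xs - 1 = graph_dist V E x y"


section \<open>The metric 1-complex of a graph\<close>

text \<open>Points of the 1-complex are given by barycentric coordinates: the support of a point
  is \<open>{v}\<close> for the vertex \<open>v\<close>, and the edge \<open>{u, v}\<close> for an inner point of that edge. The
  point of the edge \<open>{u, v}\<close> at distance \<open>t\<close> from \<open>u\<close> has coordinates \<open>1 - t\<close> at \<open>u\<close> and
  \<open>t\<close> at \<open>v\<close>.\<close>

definition point_supp :: "('a \<Rightarrow> real) \<Rightarrow> 'a set" where
  "point_supp p = {v. p v \<noteq> 0}"

definition one_complex :: "'a set \<Rightarrow> 'a set set \<Rightarrow> ('a \<Rightarrow> real) set" where
  "one_complex V E =
     {p. (\<forall>v. 0 \<le> p v) \<and> sum p (point_supp p) = 1 \<and>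
         ((\<exists>v\<in>V. point_supp p = {v}) \<or> point_supp p \<in> E)}"

text \<open>The length metric: a shortest connection of \<open>p\<close> and \<open>q\<close> either leaves through a vertex
  \<open>u\<close> of the cell of \<open>p\<close>, which is \<open>1 - p u\<close> away, and enters through a vertex \<open>v\<close> of the
  cell of \<open>q\<close>, or it stays within a common edge of \<open>p\<close> and \<open>q\<close>.
  The value off the complex is irrelevant; \<open>Metric_space\<close> asks for nonnegativity everywhere.\<close>

definition point_dist :: "'a set \<Rightarrow> 'a set set \<Rightarrow> ('a \<Rightarrow> real) \<Rightarrow> ('a \<Rightarrow> real) \<Rightarrow> real" where
  "point_dist V E p q =
     (if p \<in> one_complex V E \<and> q \<in> one_complex V E then
        Inf ({(1 - p u) + real (graph_dist V E u v) + (1 - q v) | u v.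
                u \<in> point_supp p \<and> v \<in> point_supp q} \<union>
             {\<bar>p u - q u\<bar> | u e. e \<in> E \<and> u \<in> e \<and> point_supp p \<subseteq> e \<and> point_supp q \<subseteq> e})
      else 0)"

text \<open>The metric topology; for locally finite graphs it coincides with the cell complex
  topology.\<close>

definition one_complex_topology :: "'a set \<Rightarrow> 'a set set \<Rightarrow> ('a \<Rightarrow> real) topology" where
  "one_complex_topology V E = Metric_space.mtopology (one_complex V E) (point_dist V E)"

definition planar_graph :: "'a set \<Rightarrow> 'a set set \<Rightarrow> bool" where
  "planar_graph V E \<longleftrightarrow>
     (\<exists>f. embedding_map (one_complex_topology V E) (euclidean :: complex topology) f)"

text \<open>The vertices and inner edge points on a path.\<close>

definition path_points :: "'a set \<Rightarrow> 'a set set \<Rightarrow> 'a list \<Rightarrow> ('a \<Rightarrow> real) set" where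
  "path_points V E xs =
     {p \<in> one_complex V E. (\<exists>v\<in>set xs. point_supp p = {v}) \<or>
        (\<exists>i. Suc i < length xs \<and> point_supp p = {xs ! i, xs ! Suc i})}"


section \<open>Hyperbolicity\<close>

definition delta_hyperbolic :: "real \<Rightarrow> 'a set \<Rightarrow> 'a set set \<Rightarrow> bool" where
  "delta_hyperbolic \<delta> V E \<longleftrightarrow>
     locally_finite_graph V E \<and>
     (\<forall>x\<in>V. \<forall>y\<in>V. \<forall>z\<in>V. \<forall>\<pi>\<^sub>x\<^sub>y \<pi>\<^sub>y\<^sub>z \<pi>\<^sub>z\<^sub>x.
        geodesic V E x y \<pi>\<^sub>x\<^sub>y \<longrightarrow> geodesic V E y z \<pi>\<^sub>y\<^sub>z \<longrightarrow> geodesic V E z x \<pi>\<^sub>z\<^sub>x \<longrightarrow>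
        (\<forall>\<xi> \<in> path_points V E \<pi>\<^sub>x\<^sub>y.
           \<exists>\<eta> \<in> path_points V E \<pi>\<^sub>y\<^sub>z \<union> path_points V E \<pi>\<^sub>z\<^sub>x. point_dist V E \<xi> \<eta> \<le> \<delta>))"

definition hyperbolic_graph :: "'a set \<Rightarrow> 'a set set \<Rightarrow> bool" where
  "hyperbolic_graph V E \<longleftrightarrow> (\<exists>\<delta>\<ge>0. delta_hyperbolic \<delta> V E)"


section \<open>Ends\<close>

definition ray :: "'a set \<Rightarrow> 'a set set \<Rightarrow> (nat \<Rightarrow> 'a) \<Rightarrow> bool" where
  "ray V E r \<longleftrightarrow> inj r \<and> range r \<subseteq> V \<and> (\<forall>n. {r n, r (Suc n)} \<in> E)"

definition components_minus :: "'a set \<Rightarrow> 'a set set \<Rightarrow> 'a set \<Rightarrow> 'a set set" where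
  "components_minus V E S = {{y. \<exists>xs. graph_path (V - S) E x y xs} | x. x \<in> V - S}"

definition end_rel :: "'a set \<Rightarrow> 'a set set \<Rightarrow> ((nat \<Rightarrow> 'a) \<times> (nat \<Rightarrow> 'a)) set" where
  "end_rel V E = {(r, r'). ray V E r \<and> ray V E r' \<and>
     (\<forall>S. finite S \<and> S \<subseteq> V \<longrightarrow>
        (\<exists>C \<in> components_minus V E S.
           (\<forall>\<^sub>F n in sequentially. r n \<in> C) \<and> (\<forall>\<^sub>F n in sequentially. r' n \<in> C)))}"

definition graph_ends :: "'a set \<Rightarrow> 'a set set \<Rightarrow> (nat \<Rightarrow> 'a) set set" where
  "graph_ends V E = {r. ray V E r} // end_rel V E"


section \<open>The hyperbolic boundary\<close>

definition geodetic_ray :: "'a set \<Rightarrow> 'a set set \<Rightarrow> (nat \<Rightarrow> 'a) \<Rightarrow> bool" where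
  "geodetic_ray V E r \<longleftrightarrow>
     ray V E r \<and> (\<forall>m n. m \<le> n \<longrightarrow> geodesic V E (r m) (r n) (map r [m..<Suc n]))"

definition dist_to_ray :: "'a set \<Rightarrow> 'a set set \<Rightarrow> 'a \<Rightarrow> (nat \<Rightarrow> 'a) \<Rightarrow> nat" where
  "dist_to_ray V E x r = (INF k. graph_dist V E x (r k))"

definition boundary_rel :: "'a set \<Rightarrow> 'a set set \<Rightarrow> ((nat \<Rightarrow> 'a) \<times> (nat \<Rightarrow> 'a)) set" where
  "boundary_rel V E = {(r, r'). geodetic_ray V E r \<and> geodetic_ray V E r' \<and>
     (\<exists>M::real. liminf (\<lambda>n. ereal (real (dist_to_ray V E (r n) r'))) \<le> ereal M)}"

definition hyperbolic_boundary :: "'a set \<Rightarrow> 'a set set \<Rightarrow> (nat \<Rightarrow> 'a) set set" where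
  "hyperbolic_boundary V E = {r. geodetic_ray V E r} // boundary_rel V E"


section \<open>Automorphisms\<close>

text \<open>Elements of \<open>Bij V\<close> are bijections of \<open>V\<close> made \<open>undefined\<close> outside \<open>V\<close>. The group
  \<open>BijGroup V\<close> composes from right to left, but a set of bijections is a subgroup of it iff
  it is one for the opposite composition used with right actions.\<close>

definition graph_automorphisms :: "'a set \<Rightarrow> 'a set set \<Rightarrow> ('a \<Rightarrow> 'a) set" where
  "graph_automorphisms V E =
     {g \<in> Bij V. \<forall>u\<in>V. \<forall>v\<in>V. {g u, g v} \<in> E \<longleftrightarrow> {u, v} \<in> E}"

definition automorphism_group_of :: "'a set \<Rightarrow> 'a set set \<Rightarrow> ('a \<Rightarrow> 'a) set \<Rightarrow> bool" where
  "automorphism_group_of V E \<Gamma> \<longleftrightarrow>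
     subgroup \<Gamma> (BijGroup V) \<and> \<Gamma> \<subseteq> graph_automorphisms V E"

definition vertex_transitive :: "'a set \<Rightarrow> ('a \<Rightarrow> 'a) set \<Rightarrow> bool" where
  "vertex_transitive V \<Gamma> \<longleftrightarrow> (\<forall>x\<in>V. \<forall>y\<in>V. \<exists>g\<in>\<Gamma>. g x = y)"

definition fixes_boundary_point :: "('a \<Rightarrow> 'a) \<Rightarrow> (nat \<Rightarrow> 'a) set \<Rightarrow> bool" where
  "fixes_boundary_point g \<omega> \<longleftrightarrow> (\<forall>r\<in>\<omega>. g \<circ> r \<in> \<omega>)"

end

theory Submission
  imports Defs "HOL-Algebra.Generated_Groups"
begin

text \<open>Suppose that \<open>\<Gamma>\<close> is transitive and fixes the class \<open>\<omega>\<close> of a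
  geodetic ray \<open>r\<close>. The translates of \<open>r\<close> are pairwise asymptotic, so the Busemann function
  (height) of \<open>r\<close> is \<open>\<Gamma>\<close>-invariant up to bounded errors and additive constants. An element
  moving \<open>r 0\<close> far up along \<open>r\<close> generates a coarse axis from \<open>r 0\<close> towards \<open>\<omega>\<close>. The vertices
  \<open>\<gamma> (r 0)\<close> for which \<open>\<gamma>\<close> keeps the point of the axis \<open>n\<close> steps below \<open>r 0\<close> close to the axis
  form sets that decrease with \<open>n\<close>, are invariant under translation along the axis, and are
  finite modulo this translation; hence they stabilise to a set \<open>A\<close>. Stability makes the upper
  part of \<open>A\<close> invariant under every \<open>\<gamma>\<close> moving \<open>r 0\<close> by at most one edge. Consequently the part of
  \<open>\<gamma> A\<close> above a fixed height does not change while \<open>\<gamma> (r 0)\<close> moves along a path of low height,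
  and a path climbing from far below on the axis to height \<open>0\<close> must pass close to \<open>r 0\<close>.
  So a finite ball separates \<open>r\<close> from the downward direction of the axis, and \<open>G\<close> has more than
  one end.\<close>

section \<open>The metric of a connected graph\<close>

text \<open>Cutting out the closed piece between two visits of a repeated vertex shortens a walk
  until a path remains. \<open>graph_path\<close> demands distinct vertices, so walks must be
  reduced in this way.\<close>

lemma successively_distinct:
  assumes "successively R xs" "xs \<noteq> []"
  obtains ys where "ys \<noteq> []" "hd ys = hd xs" "last ys = last xs" "set ys \<subseteq> set xs"
    "distinct ys" "successively R ys" "length ys \<le> length xs"
proof -
  have "\<exists>ys. ys \<noteq> [] \<and> hd ys = hd xs \<and> last ys = last xs \<and> set ys \<subseteq> set xs \<and>
      distinct ys \<and> successively R ys \<and> length ys \<le> length xs"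
    using assms
  proof (induction xs rule: length_induct)
    case (1 xs)
    show ?case
    proof (cases "distinct xs")
      case True
      with 1 show ?thesis by (intro exI[of _ xs]) auto
    next
      case False
      then obtain a y b e where xs: "xs = a @ [y] @ b @ [y] @ e" using not_distinct_decomp by blast
      let ?ys = "a @ [y] @ e"
      have "successively R ?ys" "hd ?ys = hd xs" "last ?ys = last xs" "length ?ys < length xs"
        using 1(2) unfolding xs by (auto simp: successively_append_iff successively_Cons hd_append)
      moreover have "set ?ys \<subseteq> set xs" by (auto simp: xs)
      moreover have "?ys \<noteq> []" by simp
      ultimately show ?thesis using 1(1)[rule_format, of ?ys] by fastforce
    qed
  qed
  then show thesis using that by blast
qed

section \<open>Distances, geodesics and balls\<close>

locale locally_finite_connected =
  fixes V :: "'a set" and E :: "'a set set"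
  assumes simple: "simple_graph V E" and locally_finite: "locally_finite_graph V E"
    and connected: "connected_graph V E"
begin

abbreviation gdist :: "'a \<Rightarrow> 'a \<Rightarrow> nat" where "gdist \<equiv> graph_dist V E"

abbreviation adj :: "'a \<Rightarrow> 'a \<Rightarrow> bool" where "adj u v \<equiv> {u, v} \<in> E"

lemma adj_V: "adj u v \<Longrightarrow> u \<in> V \<and> v \<in> V"
  using simple by (auto simp: simple_graph_def)

text \<open>Bounding by walks lets geodesics be concatenated, reversed or mapped without checking
  distinctness.\<close>

lemma gdist_le:
  assumes "xs \<noteq> []" "set xs \<subseteq> V" "successively adj xs"
  shows "gdist (hd xs) (last xs) \<le> length xs - 1"
proof -
  obtain ys where ys: "ys \<noteq> []" "hd ys = hd xs" "last ys = last xs" "set ys \<subseteq> set xs"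
    "distinct ys" "successively adj ys" "length ys \<le> length xs"
    using successively_distinct[OF assms(3,1)] .
  have "gdist (hd xs) (last xs) \<le> length ys - 1"
    unfolding graph_dist_def using ys assms(2)
    by (intro Least_le exI[of _ ys]) (auto simp: graph_path_def)
  then show ?thesis using ys(7) by simp
qed

lemma geodesic_exists:
  assumes "x \<in> V" "y \<in> V" obtains xs where "geodesic V E x y xs"
proof -
  have "\<exists>n xs. graph_path V E x y xs \<and> length xs - 1 = n"
    using connected assms by (auto simp: connected_graph_def)
  from LeastI_ex[OF this] show thesis
    using that unfolding geodesic_def graph_dist_def by blast
qed

lemma geodesicD:
  assumes "geodesic V E x y xs"
  shows "xs \<noteq> []" "hd xs = x" "last xs = y" "set xs \<subseteq> V" "successively adj xs"
    "length xs = Suc (gdist x y)"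
  using assms by (auto simp: geodesic_def graph_path_def Suc_diff_le length_greater_0_conv[symmetric]
      simp del: length_greater_0_conv)

lemma gdist_self: "x \<in> V \<Longrightarrow> gdist x x = 0"
  using gdist_le[of "[x]"] by simp

lemma gdist_adj_le: "adj x y \<Longrightarrow> gdist x y \<le> 1"
  using gdist_le[of "[x, y]"] adj_V[of x y] by simp

lemma gdist_sym_le:
  assumes "x \<in> V" "y \<in> V" shows "gdist x y \<le> gdist y x"
proof -
  obtain xs where xs: "geodesic V E y x xs" using geodesic_exists assms by blast
  note * = geodesicD[OF xs]
  have "successively adj (rev xs)" using *(5) by (simp add: insert_commute)
  then show ?thesis using gdist_le[of "rev xs"] * by (simp add: hd_rev last_rev)
qed

lemma gdist_sym: "x \<in> V \<Longrightarrow> y \<in> V \<Longrightarrow> gdist x y = gdist y x"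
  using gdist_sym_le by (simp add: eq_iff)

lemma gdist_triangle:
  assumes "x \<in> V" "y \<in> V" "z \<in> V" shows "gdist x z \<le> gdist x y + gdist y z"
proof -
  obtain xs where xs: "geodesic V E x y xs" using geodesic_exists assms by blast
  obtain ys where ys: "geodesic V E y z ys" using geodesic_exists assms by blast
  note X = geodesicD[OF xs] and Y = geodesicD[OF ys]
  obtain ys' where ys': "ys = y # ys'" using Y(1,2) by (cases ys) auto
  have "successively adj (xs @ ys')"
    using X Y unfolding ys' by (cases ys') (auto simp: successively_append_iff successively_Cons)
  moreover have "last (xs @ ys') = z" using X Y ys' by (cases ys') auto
  moreover have "hd (xs @ ys') = x" using X by simp
  ultimately show ?thesis using gdist_le[of "xs @ ys'"] X Y ys' by auto
qed

lemma adj_if_gdist_1: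
  assumes "x \<in> V" "y \<in> V" "gdist x y = 1" shows "adj x y"
proof -
  obtain xs where "geodesic V E x y xs" using geodesic_exists assms by blast
  from geodesicD[OF this] assms(3) show ?thesis
    by (cases xs rule: list.exhaust; cases "tl xs" rule: list.exhaust) auto
qed

lemma gdist_geodesic_start:
  assumes "geodesic V E x y xs" "w \<in> set xs" shows "gdist x w \<le> gdist x y"
proof -
  note X = geodesicD[OF assms(1)]
  obtain as bs where xs: "xs = as @ w # bs" using assms(2) by (auto simp: in_set_conv_decomp)
  have "successively adj (as @ [w])" using X(5) unfolding xs by (auto simp: successively_append_iff)
  moreover have "hd (as @ [w]) = x" using X(2) unfolding xs by (cases as) auto
  ultimately show ?thesis using gdist_le[of "as @ [w]"] X(4,6) unfolding xs by auto
qed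

lemma finite_adj: "v \<in> V \<Longrightarrow> finite {w. adj v w}"
proof -
  assume v: "v \<in> V"
  have "finite {e \<in> E. v \<in> e}" using locally_finite v by (auto simp: locally_finite_graph_def)
  moreover have "finite e" if "e \<in> E" for e
    using simple that by (intro card_ge_0_finite) (auto simp: simple_graph_def)
  ultimately have "finite (\<Union> {e \<in> E. v \<in> e})" by auto
  then show ?thesis by (rule finite_subset[rotated]) auto
qed

lemma finite_gball:
  assumes "u \<in> V" shows "finite {v \<in> V. gdist u v \<le> n}"
proof (induction n)
  case 0
  have "v = u" if v: "v \<in> V" "gdist u v = 0" for v
  proof -
    obtain xs where "geodesic V E u v xs" using geodesic_exists assms v(1) by blast
    note X = geodesicD[OF this, unfolded v(2)]
    obtain a where "xs = [a]" using X(6) by (cases xs) auto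
    then show ?thesis using X(2,3) by simp
  qed
  then have "{v \<in> V. gdist u v \<le> 0} \<subseteq> {u}" by auto
  then show ?case by (rule finite_subset) simp
next
  case (Suc n)
  let ?B = "{v \<in> V. gdist u v \<le> n}"
  have "{v \<in> V. gdist u v \<le> Suc n} \<subseteq> ?B \<union> (\<Union>w\<in>?B. {v. adj w v})"
  proof
    fix v assume "v \<in> {v \<in> V. gdist u v \<le> Suc n}"
    then have v: "v \<in> V" "gdist u v \<le> Suc n" by auto
    show "v \<in> ?B \<union> (\<Union>w\<in>?B. {v. adj w v})"
    proof (cases "gdist u v \<le> n")
      case False
      then have e: "gdist u v = Suc n" using v by simp
      obtain xs where "geodesic V E u v xs" using geodesic_exists assms v by blast
      note X = geodesicD[OF this, unfolded e]
      define ys where "ys = butlast xs"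
      have xs: "xs = ys @ [v]" using X(1,3) unfolding ys_def by (metis append_butlast_last_id)
      have ys: "ys \<noteq> []" using X(6) xs by auto
      then have "adj (last ys) v" "successively adj ys" "hd ys = u"
        using X unfolding xs by (auto simp: successively_append_iff)
      moreover have "set ys \<subseteq> V" "length ys = Suc n" using X(4,6) unfolding xs by auto
      ultimately have "gdist u (last ys) \<le> n" "adj (last ys) v" using gdist_le[of ys] ys by auto
      then show ?thesis using adj_V by blast
    qed (use v in simp)
  qed
  moreover have "finite (?B \<union> (\<Union>w\<in>?B. {v. adj w v}))" using Suc finite_adj by auto
  ultimately show ?case by (rule finite_subset)
qed

lemma gdist_automorphism_le:
  assumes g: "g \<in> graph_automorphisms V E" and "u \<in> V" "v \<in> V"
  shows "gdist (g u) (g v) \<le> gdist u v"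
proof -
  obtain xs where "geodesic V E u v xs" using geodesic_exists assms by blast
  note X = geodesicD[OF this]
  have gV: "g w \<in> V" if "w \<in> V" for w
    using g that Bij_imp_funcset by (fastforce simp: graph_automorphisms_def)
  have "successively (\<lambda>u v. adj (g u) (g v)) xs"
    using X(5) by (rule successively_mono) (use g adj_V in \<open>auto simp: graph_automorphisms_def\<close>)
  then have "successively adj (map g xs)" by (simp add: successively_map)
  moreover have "set (map g xs) \<subseteq> V" using X(4) gV by auto
  ultimately show ?thesis using gdist_le[of "map g xs"] X by (simp add: hd_map last_map)
qed

section \<open>Slim triangles in terms of vertices\<close>

text \<open>The vertex \<open>u\<close> becomes the point \<open>p\<close> concentrated at
  \<open>u\<close>, and the nearby point \<open>q\<close> is exchanged for a vertex of its support,
  which lies on the same side of the triangle. The alternative \<open>1\<close> covers points on a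
  common edge.\<close>

lemma delta_hyperbolic_slim:
  assumes hyp: "delta_hyperbolic \<delta> V E"
    and geo: "geodesic V E x y P" "geodesic V E y z Q" "geodesic V E z x S" and u: "u \<in> set P"
  shows "\<exists>w \<in> set Q \<union> set S. real (gdist u w) \<le> max 1 (\<delta> + 1)"
proof -
  note P = geodesicD[OF geo(1)] and Q = geodesicD[OF geo(2)]
  have V: "x \<in> V" "y \<in> V" "z \<in> V" "u \<in> V" 
    using P Q u hd_in_set[of P] hd_in_set[of Q] last_in_set[of Q] by auto
  define p :: "'a \<Rightarrow> real" where "p = (\<lambda>v. if v = u then 1 else 0)"
  have supp: "point_supp p = {u}" by (auto simp: point_supp_def p_def)
  have p1: "p \<in> one_complex V E" unfolding one_complex_def using supp V(4) by (auto simp: p_def)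
  have "p \<in> path_points V E P" unfolding path_points_def using p1 supp u by auto
  then obtain q where q: "q \<in> path_points V E Q \<union> path_points V E S" "point_dist V E p q \<le> \<delta>"
    using hyp geo V unfolding delta_hyperbolic_def by blast
  have q1: "q \<in> one_complex V E" using q(1) by (auto simp: path_points_def)
  have sub: "point_supp q \<subseteq> set Q \<union> set S"
    using q(1) by (auto simp: path_points_def)
  have fin: "finite (point_supp q)" using q(1) by (auto simp: path_points_def)
  have ne: "point_supp q \<noteq> {}" using q(1) by (auto simp: path_points_def)
  have q_le: "q v \<le> 1" if "v \<in> point_supp q" for v
    using q1 member_le_sum[OF that, of q] fin by (auto simp: one_complex_def)
  let ?X = "{(1 - p u) + real (gdist u v) + (1 - q v) | u v. u \<in> point_supp p \<and> v \<in> point_supp q} \<union>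
             {\<bar>p u - q u\<bar> | u e. e \<in> E \<and> u \<in> e \<and> point_supp p \<subseteq> e \<and> point_supp q \<subseteq> e}"
  have "?X \<noteq> {}" using ne supp by auto
  \<comment> \<open>The summand 1 is slack: it makes the bound on the infimum strict, so that a
    member \<open>s\<close> below it exists.\<close>
  moreover have "Inf ?X < \<delta> + 1" using q(2) p1 q1 by (simp add: point_dist_def)
  ultimately obtain s where s: "s \<in> ?X" "s < \<delta> + 1" using cInf_lessD by meson
  from s(1) show ?thesis
  proof
    assume "s \<in> {(1 - p u) + real (gdist u v) + (1 - q v) | u v. u \<in> point_supp p \<and> v \<in> point_supp q}"
    then obtain v where v: "v \<in> point_supp q" "s = (1 - p u) + real (gdist u v) + (1 - q v)"
      using supp by auto
    then have "real (gdist u v) \<le> \<delta> + 1" using s(2) q_le[of v] by (simp add: p_def)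
    then show ?thesis using v(1) sub by (intro bexI[of _ v]) auto
  next
    assume "s \<in> {\<bar>p u - q u\<bar> | u e. e \<in> E \<and> u \<in> e \<and> point_supp p \<subseteq> e \<and> point_supp q \<subseteq> e}"
    then obtain e where e: "e \<in> E" "u \<in> e" "point_supp q \<subseteq> e" using supp by auto
    obtain v where v: "v \<in> point_supp q" using ne by auto
    have "card e = 2" using e simple by (auto simp: simple_graph_def)
    then obtain a b where ab: "e = {a, b}" by (auto simp: card_2_iff)
    have "gdist u v \<le> 1"
    proof (cases "v = u")
      case False
      then have "e = {u, v}" using ab e v by auto
      then show ?thesis using gdist_adj_le e by auto
    qed (use gdist_self V in simp)
    then show ?thesis using v sub by (intro bexI[of _ v]) auto
  qed
qed

lemma hyperbolic_slim:
  assumes "hyperbolic_graph V E"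
  obtains D where "\<And>x y z P Q S u. geodesic V E x y P \<Longrightarrow> geodesic V E y z Q \<Longrightarrow>
    geodesic V E z x S \<Longrightarrow> u \<in> set P \<Longrightarrow> \<exists>w \<in> set Q \<union> set S. gdist u w \<le> D"
proof -
  obtain \<delta> where \<delta>: "\<delta> \<ge> 0" "delta_hyperbolic \<delta> V E" using assms by (auto simp: hyperbolic_graph_def)
  have "\<exists>w \<in> set Q \<union> set S. gdist u w \<le> nat \<lceil>\<delta> + 1\<rceil>"
    if geo: "geodesic V E x y P" "geodesic V E y z Q" "geodesic V E z x S" "u \<in> set P" for x y z P Q S u
  proof -
    obtain w where w: "w \<in> set Q \<union> set S" "real (gdist u w) \<le> max 1 (\<delta> + 1)"
      using delta_hyperbolic_slim[OF \<delta>(2) geo] by blast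
    then have "real (gdist u w) \<le> \<delta> + 1" using \<delta>(1) by simp
    then have "gdist u w \<le> nat \<lceil>\<delta> + 1\<rceil>" by linarith
    with w show ?thesis by blast
  qed
  then show thesis using that by blast
qed

section \<open>Geodetic rays and their equivalence\<close>

lemma geodetic_ray_dist:
  assumes "geodetic_ray V E \<rho>" shows "int (gdist (\<rho> m) (\<rho> n)) = \<bar>int m - int n\<bar>"
proof -
  have V: "\<rho> n \<in> V" for n using assms by (auto simp: geodetic_ray_def ray_def)
  have *: "gdist (\<rho> m) (\<rho> n) = n - m" if "m \<le> n" for m n
  proof -
    have "geodesic V E (\<rho> m) (\<rho> n) (map \<rho> [m..<Suc n])" using assms that by (simp add: geodetic_ray_def)
    from geodesicD(6)[OF this] show ?thesis using that by simp
  qed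
  show ?thesis
  proof (cases "m \<le> n")
    case True then show ?thesis using * by simp
  next
    case False then show ?thesis using *[of n m] gdist_sym[OF V V, of m n] by simp
  qed
qed

text \<open>A liminf of at most \<open>M\<close> forbids that all late distances reach
  \<open>M + 1\<close>. The bound depends on the rays and concerns infinitely many indices only;
  \<open>rays_merge\<close> turns it into a uniform bound for all late indices.\<close>

lemma boundary_rel_dist:
  assumes "(\<rho>, \<sigma>) \<in> boundary_rel V E"
  obtains M where "\<And>N. \<exists>n\<ge>N. \<exists>k. gdist (\<rho> n) (\<sigma> k) \<le> M"
proof -
  obtain M :: real where M: "liminf (\<lambda>n. ereal (real (dist_to_ray V E (\<rho> n) \<sigma>))) \<le> ereal M"
    using assms by (auto simp: boundary_rel_def)
  have "\<exists>n\<ge>N. \<exists>k. gdist (\<rho> n) (\<sigma> k) \<le> nat \<lceil>M + 1\<rceil>" for N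
  proof (rule ccontr)
    assume neg: "\<not> ?thesis"
    have "ereal (M + 1) \<le> ereal (real (dist_to_ray V E (\<rho> n) \<sigma>))" if "n \<ge> N" for n
    proof -
      have "dist_to_ray V E (\<rho> n) \<sigma> \<in> range (\<lambda>k. gdist (\<rho> n) (\<sigma> k))"
        unfolding dist_to_ray_def by (rule Inf_nat_def1) simp
      then have "\<not> dist_to_ray V E (\<rho> n) \<sigma> \<le> nat \<lceil>M + 1\<rceil>" using neg that by auto
      then show ?thesis by simp linarith
    qed
    then have "ereal (M + 1) \<le> liminf (\<lambda>n. ereal (real (dist_to_ray V E (\<rho> n) \<sigma>)))"
      by (intro Liminf_bounded eventually_sequentiallyI[of N])
    then show False using M order_trans by fastforce
  qed
  then show thesis using that by blast
qed

lemma boundary_rel_refl: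
  assumes "geodetic_ray V E \<rho>" shows "(\<rho>, \<rho>) \<in> boundary_rel V E"
proof -
  have "\<rho> n \<in> V" for n using assms by (auto simp: geodetic_ray_def ray_def)
  then have "dist_to_ray V E (\<rho> n) \<rho> = 0" for n
    unfolding dist_to_ray_def using gdist_self cINF_lower[of "\<lambda>k. gdist (\<rho> n) (\<rho> k)" UNIV n] by simp
  then show ?thesis using assms by (auto simp: boundary_rel_def Liminf_const intro!: exI[of _ 0])
qed

text \<open>Slimness of the quadrilateral \<open>\<rho> 0, \<rho> N, \<sigma> m, \<sigma> t\<close> for a far away pair of close
  points \<open>\<rho> N, \<sigma> m\<close>.\<close>

lemma rays_merge:
  assumes slim: "\<And>x y z P Q S u. geodesic V E x y P \<Longrightarrow> geodesic V E y z Q \<Longrightarrow>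
      geodesic V E z x S \<Longrightarrow> u \<in> set P \<Longrightarrow> \<exists>w \<in> set Q \<union> set S. gdist u w \<le> D"
    and \<rho>: "geodetic_ray V E \<rho>" and \<sigma>: "geodetic_ray V E \<sigma>"
    and close: "\<And>N. \<exists>n\<ge>N. \<exists>k. gdist (\<rho> n) (\<sigma> k) \<le> M"
    and n: "gdist (\<rho> 0) (\<sigma> t) + 2 * D < n"
  shows "\<exists>m. gdist (\<rho> n) (\<sigma> m) \<le> 2 * D"
proof -
  have V: "\<rho> n \<in> V" "\<sigma> n \<in> V" for n using \<rho> \<sigma> by (auto simp: geodetic_ray_def ray_def)
  obtain N m where N: "N \<ge> n + M + 2 * D + t + gdist (\<rho> 0) (\<sigma> 0) + 1" "gdist (\<rho> N) (\<sigma> m) \<le> M"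
    using close by blast
  have "int N \<le> int M + int m + int (gdist (\<sigma> 0) (\<rho> 0))"
    using gdist_triangle[OF V(1)[of N] V(2)[of m] V(1)[of 0]] gdist_triangle[OF V(2)[of m] V(2)[of 0] V(1)[of 0]]
      geodetic_ray_dist[OF \<rho>, of N 0] geodetic_ray_dist[OF \<sigma>, of m 0] N(2) by linarith
  then have tm: "t \<le> m" using N(1) gdist_sym[OF V(1)[of 0] V(2)[of 0]] by linarith
  have P: "geodesic V E (\<rho> 0) (\<rho> N) (map \<rho> [0..<Suc N])" using \<rho> by (simp add: geodetic_ray_def)
  have S': "geodesic V E (\<sigma> t) (\<sigma> m) (map \<sigma> [t..<Suc m])" using \<sigma> tm by (simp add: geodetic_ray_def)
  obtain Q where Q: "geodesic V E (\<rho> N) (\<sigma> m) Q" using geodesic_exists V by blast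
  \<comment> \<open>The diagonal \<open>S\<close> cuts the quadrilateral into two triangles, each
    costing \<open>D\<close>.\<close>
  obtain S where S: "geodesic V E (\<sigma> m) (\<rho> 0) S" using geodesic_exists V by blast
  obtain Q' where Q': "geodesic V E (\<rho> 0) (\<sigma> t) Q'" using geodesic_exists V by blast
  have "\<rho> n \<in> set (map \<rho> [0..<Suc N])" using N(1) by auto
  from slim[OF P Q S this] obtain w where w: "w \<in> set Q \<union> set S" "gdist (\<rho> n) w \<le> D" by blast
  have wV: "w \<in> V" using w(1) geodesicD(4)[OF Q] geodesicD(4)[OF S] by auto
  have "w \<notin> set Q"
  proof
    assume "w \<in> set Q"
    then have "gdist (\<rho> N) w \<le> M" using gdist_geodesic_start[OF Q] N(2) by (meson order_trans)
    then have "gdist (\<rho> N) (\<rho> n) \<le> M + D"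
      using gdist_triangle[OF V(1)[of N] wV V(1)[of n]] w(2) gdist_sym[OF V(1)[of n] wV] by linarith
    then show False using geodetic_ray_dist[OF \<rho>, of N n] N(1) by linarith
  qed
  then have "w \<in> set S" using w by auto
  from slim[OF S Q' S' this] obtain z where z: "z \<in> set Q' \<union> set (map \<sigma> [t..<Suc m])" "gdist w z \<le> D"
    by blast
  have zV: "z \<in> V" using z(1) geodesicD(4)[OF Q'] V by auto
  have nz: "gdist (\<rho> n) z \<le> 2 * D" using gdist_triangle[OF V(1) wV zV, of n] w(2) z(2) by linarith
  have "z \<notin> set Q'"
  proof
    assume "z \<in> set Q'"
    then have "gdist (\<rho> 0) z \<le> gdist (\<rho> 0) (\<sigma> t)" by (rule gdist_geodesic_start[OF Q'])
    then have "gdist (\<rho> 0) (\<rho> n) \<le> gdist (\<rho> 0) (\<sigma> t) + 2 * D"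
      using gdist_triangle[OF V(1)[of 0] zV V(1)[of n]] nz gdist_sym[OF V(1)[of n] zV] by linarith
    then show False using geodetic_ray_dist[OF \<rho>, of 0 n] n by linarith
  qed
  then show ?thesis using z(1) nz by auto
qed

section \<open>Rays and ends\<close>

text \<open>An injective ray visits a finite set finitely often; its later segments are paths
  avoiding the set, so the tail lies in one component.\<close>

lemma end_rel_refl:
  assumes \<rho>: "ray V E \<rho>" shows "(\<rho>, \<rho>) \<in> end_rel V E"
proof -
  have "\<exists>C \<in> components_minus V E S. \<forall>\<^sub>F n in sequentially. \<rho> n \<in> C" if S: "finite S" for S
  proof -
    have inj: "inj \<rho>" and V: "\<And>n. \<rho> n \<in> V" and adj: "\<And>n. adj (\<rho> n) (\<rho> (Suc n))"
      using \<rho> by (auto simp: ray_def)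
    have "finite (\<rho> -` S)" using S inj by (rule finite_vimageI)
    then obtain N where N: "\<And>n. n \<ge> N \<Longrightarrow> \<rho> n \<notin> S"
      by (meson finite_nat_set_iff_bounded not_less vimageI)
    define C where "C = {y. \<exists>xs. graph_path (V - S) E (\<rho> N) y xs}"
    have "\<rho> n \<in> C" if "n \<ge> N" for n
    proof -
      have "successively adj (map \<rho> [N..<Suc n])"
        unfolding successively_conv_nth using adj by (simp del: upt_Suc)
      moreover have "distinct (map \<rho> [N..<Suc n])" using inj by (simp add: distinct_map inj_on_def inj_def)
      moreover have "hd (map \<rho> [N..<Suc n]) = \<rho> N" using that by (simp add: hd_map del: upt_Suc)
      ultimately have "graph_path (V - S) E (\<rho> N) (\<rho> n) (map \<rho> [N..<Suc n])"
        using that N V by (auto simp: graph_path_def)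
      then show ?thesis unfolding C_def by blast
    qed
    then have "\<forall>\<^sub>F n in sequentially. \<rho> n \<in> C" by (rule eventually_sequentiallyI)
    moreover have "C \<in> components_minus V E S"
      unfolding components_minus_def C_def using N[of N] V by auto
    ultimately show ?thesis by blast
  qed
  then show ?thesis using \<rho> by (auto simp: end_rel_def)
qed

text \<open>Both classes are ends, so they coincide, and by reflexivity \<open>\<sigma>\<close> lies
  in its own class.\<close>

lemma one_end_rel:
  assumes "\<exists>!\<epsilon>. \<epsilon> \<in> graph_ends V E" and \<rho>: "ray V E \<rho>" and \<sigma>: "ray V E \<sigma>"
  shows "(\<rho>, \<sigma>) \<in> end_rel V E"
proof -
  have "end_rel V E `` {\<rho>} \<in> graph_ends V E" "end_rel V E `` {\<sigma>} \<in> graph_ends V E"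
    using \<rho> \<sigma> by (auto simp: graph_ends_def intro: quotientI)
  then have "end_rel V E `` {\<rho>} = end_rel V E `` {\<sigma>}" using assms(1) by blast
  then show ?thesis using end_rel_refl[OF \<sigma>] by blast
qed

text \<open>Loop erasure: from each vertex continue after the last visit of the walk.\<close>

lemma ray_of_walk:
  assumes w: "\<And>n. adj (w n) (w (Suc n))" and fin: "\<And>v. finite {n. w n = v}"
  obtains f where "strict_mono f" "ray V E (\<lambda>i. w (f i))"
proof -
  define last_visit where "last_visit n = Max {m. w m = w n}" for n
  have lv: "w (last_visit n) = w n" "n \<le> last_visit n" "\<And>m. w m = w n \<Longrightarrow> m \<le> last_visit n" for n
    unfolding last_visit_def using Max_in[OF fin, of "w n"] Max_ge[OF fin, of _ "w n"] by auto
  define f where "f = rec_nat (last_visit 0) (\<lambda>_ n. last_visit (Suc n))"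
  have f: "f 0 = last_visit 0" "\<And>i. f (Suc i) = last_visit (Suc (f i))" by (simp_all add: f_def)
  have f_last: "w m = w (f i) \<Longrightarrow> m \<le> f i" for i m
    by (cases i) (auto simp: f lv(1) intro: lv(3))
  have "f i < f (Suc i)" for i using lv(2)[of "Suc (f i)"] by (simp add: f)
  then have mono: "strict_mono f" by (simp add: strict_mono_Suc_iff)
  have "inj (\<lambda>i. w (f i))"
  proof (rule injI)
    fix i j assume "w (f i) = w (f j)"
    then have "f i = f j" using f_last[of "f i" j] f_last[of "f j" i] by simp
    then show "i = j" using mono by (simp add: strict_mono_eq)
  qed
  moreover have "adj (w (f i)) (w (f (Suc i)))" for i using w[of "f i"] by (simp add: f lv(1))
  ultimately have "ray V E (\<lambda>i. w (f i))" using adj_V[OF w] by (auto simp: ray_def)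
  with mono show thesis by (rule that)
qed

end


section \<open>Isometric actions fixing a point at infinity\<close>

locale bijection_group =
  fixes V :: "'a set" and \<Gamma> :: "('a \<Rightarrow> 'a) set"
  assumes subgroup: "subgroup \<Gamma> (BijGroup V)"
begin

abbreviation mul (infixl "\<odot>" 70) where "\<gamma> \<odot> \<eta> \<equiv> \<gamma> \<otimes>\<^bsub>BijGroup V\<^esub> \<eta>"

lemma Bij: "\<gamma> \<in> \<Gamma> \<Longrightarrow> \<gamma> \<in> Bij V"
  using subgroup.subset[OF subgroup] by (auto simp: BijGroup_def)

lemma act [simp]: "\<gamma> \<in> \<Gamma> \<Longrightarrow> u \<in> V \<Longrightarrow> \<gamma> u \<in> V"
  using Bij_imp_funcset[OF Bij] by auto

lemma mul_act: "\<gamma> \<in> \<Gamma> \<Longrightarrow> \<eta> \<in> \<Gamma> \<Longrightarrow> u \<in> V \<Longrightarrow> (\<gamma> \<odot> \<eta>) u = \<gamma> (\<eta> u)"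
  by (simp add: BijGroup_def Bij compose_def)

lemma mul_closed: "\<gamma> \<in> \<Gamma> \<Longrightarrow> \<eta> \<in> \<Gamma> \<Longrightarrow> \<gamma> \<odot> \<eta> \<in> \<Gamma>"
  by (rule subgroup.m_closed[OF subgroup])

lemma one_closed: "\<one>\<^bsub>BijGroup V\<^esub> \<in> \<Gamma>"
  by (rule subgroup.one_closed[OF subgroup])

lemma one_act: "u \<in> V \<Longrightarrow> \<one>\<^bsub>BijGroup V\<^esub> u = u"
  by (simp add: BijGroup_def)

lemma inverse_in: "\<gamma> \<in> \<Gamma> \<Longrightarrow> \<exists>\<eta>\<in>\<Gamma>. (\<forall>u\<in>V. \<eta> (\<gamma> u) = u) \<and> (\<forall>u\<in>V. \<gamma> (\<eta> u) = u)"
proof -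
  assume g: "\<gamma> \<in> \<Gamma>"
  interpret G: group "BijGroup V" by (rule group_BijGroup)
  have i: "inv\<^bsub>BijGroup V\<^esub> \<gamma> \<in> \<Gamma>" by (rule subgroup.m_inv_closed[OF subgroup g])
  have c: "\<gamma> \<in> carrier (BijGroup V)" using g subgroup.subset[OF subgroup] by auto
  have "(inv\<^bsub>BijGroup V\<^esub> \<gamma>) (\<gamma> u) = u \<and> \<gamma> ((inv\<^bsub>BijGroup V\<^esub> \<gamma>) u) = u" if "u \<in> V" for u
    using mul_act[OF i g that] mul_act[OF g i that] c that by (simp add: one_act)
  with i show ?thesis by blast
qed

end

text \<open>Isolates what hyperbolicity contributes: by \<open>merge\<close>, translates of
  \<open>r\<close> come within the uniform distance \<open>c\<close>, and only the time of merging
  depends on where they start. The metric is integer-valued so that heights can be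
  subtracted.\<close>

locale focal_action = bijection_group V \<Gamma> for V :: "'a set" and \<Gamma> +
  fixes d :: "'a \<Rightarrow> 'a \<Rightarrow> int" and r :: "nat \<Rightarrow> 'a" and c :: nat
  assumes dist_self: "u \<in> V \<Longrightarrow> d u u = 0"
    and dist_nonneg: "0 \<le> d u v"
    and dist_sym: "u \<in> V \<Longrightarrow> v \<in> V \<Longrightarrow> d u v = d v u"
    and dist_tri: "u \<in> V \<Longrightarrow> v \<in> V \<Longrightarrow> w \<in> V \<Longrightarrow> d u w \<le> d u v + d v w"
    and finite_ball: "u \<in> V \<Longrightarrow> finite {v \<in> V. d u v \<le> R}"
    and isometry: "\<gamma> \<in> \<Gamma> \<Longrightarrow> u \<in> V \<Longrightarrow> v \<in> V \<Longrightarrow> d (\<gamma> u) (\<gamma> v) = d u v"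
    and transitive: "u \<in> V \<Longrightarrow> v \<in> V \<Longrightarrow> \<exists>\<gamma>\<in>\<Gamma>. \<gamma> u = v"
    and r_in [simp]: "r n \<in> V"
    and r_dist: "d (r m) (r n) = \<bar>int m - int n\<bar>"
    and merge: "\<gamma> \<in> \<Gamma> \<Longrightarrow> \<eta> \<in> \<Gamma> \<Longrightarrow> d (\<gamma> (r 0)) (\<eta> (r t)) + int c < int n \<Longrightarrow>
      \<exists>m. d (\<gamma> (r n)) (\<eta> (r m)) \<le> int c"
begin

section \<open>The height function\<close>

lemma merge0: "\<gamma> \<in> \<Gamma> \<Longrightarrow> d (\<gamma> (r 0)) (r t) + int c < int n \<Longrightarrow> \<exists>m. d (\<gamma> (r n)) (r m) \<le> int c"
  using merge[OF _ one_closed, of \<gamma> t n] by (simp add: one_act)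

text \<open>The Busemann function of \<open>r\<close>, signed so as to grow towards the boundary
  point. The integer sequence becomes constant, so its limit is taken as its eventual value.\<close>

definition height :: "'a \<Rightarrow> int" where
  "height v = (SOME a. \<forall>\<^sub>F n in sequentially. int n - d v (r n) = a)"

lemma height_eventually:
  assumes v: "v \<in> V"
  shows "\<forall>\<^sub>F n in sequentially. int n - d v (r n) = height v"
proof -
  let ?f = "\<lambda>n. int n - d v (r n)"
  have mono: "?f n \<le> ?f (n + k)" for n k
    using dist_tri[OF v r_in[of n] r_in[of "n + k"]] r_dist[of n "n + k"] by simp
  have bd: "?f n \<le> d v (r 0)" for n
    using dist_tri[OF r_in[of 0] v r_in[of n]] r_dist[of 0 n] dist_sym[OF v r_in[of 0]] by simp
  \<comment> \<open>An index with least gap to the upper bound; by monotonicity the value stays the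
    same from there on.\<close>
  obtain N where N: "\<And>m. nat (d v (r 0) - ?f N) \<le> nat (d v (r 0) - ?f m)"
    using ex_has_least_nat[of "\<lambda>_. True" _ "\<lambda>n. nat (d v (r 0) - ?f n)"] by auto
  have "?f n = ?f N" if "N \<le> n" for n
    using N[of n] bd[of n] bd[of N] mono[of N "n - N"] that by simp
  then have "\<forall>\<^sub>F n in sequentially. ?f n = ?f N"
    by (rule eventually_sequentiallyI)
  then show ?thesis unfolding height_def
    by (rule someI[where P = "\<lambda>a. \<forall>\<^sub>F n in sequentially. ?f n = a"])
qed

lemma height_lipschitz:
  assumes "u \<in> V" "v \<in> V"
  shows "\<bar>height u - height v\<bar> \<le> d u v"
proof -
  have "\<forall>\<^sub>F n in sequentially. int n - d u (r n) = height u \<and> int n - d v (r n) = height v"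
    using assms by (intro eventually_conj height_eventually)
  then obtain n where "int n - d u (r n) = height u" "int n - d v (r n) = height v"
    by (auto simp: eventually_sequentially)
  then show ?thesis
    using dist_tri[OF assms r_in[of n]] dist_tri[OF assms(2,1) r_in[of n]] dist_sym[OF assms] by simp
qed

lemma height_r: "height (r n) = int n"
proof -
  have "\<forall>\<^sub>F m in sequentially. int m - d (r n) (r m) = height (r n) \<and> n \<le> m"
    by (intro eventually_conj height_eventually eventually_ge_at_top) simp
  then obtain m where "int m - d (r n) (r m) = height (r n)" "n \<le> m"
    by (auto simp: eventually_sequentially)
  then show ?thesis by (simp add: r_dist)
qed

text \<open>Far out, \<open>\<gamma> (r m)\<close> lies within \<open>c\<close> of some
  \<open>r n\<close>, so \<open>d (\<gamma> w) (r n)\<close> and \<open>d w (r m)\<close> agree up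
  to \<open>c\<close>. In a difference of two heights the index terms cancel and this error occurs
  twice.\<close>

lemma height_quasi_invariant:
  assumes g: "\<gamma> \<in> \<Gamma>" and uv: "u \<in> V" "v \<in> V"
  shows "\<bar>(height (\<gamma> u) - height (\<gamma> v)) - (height u - height v)\<bar> \<le> 2 * int c"
proof -
  have "\<forall>\<^sub>F n in sequentially. (int n - d u (r n) = height u \<and> int n - d v (r n) = height v) \<and>
     (int n - d (\<gamma> u) (r n) = height (\<gamma> u) \<and> int n - d (\<gamma> v) (r n) = height (\<gamma> v))"
    using uv g by (intro eventually_conj height_eventually) auto
  then obtain N where N: "\<And>n. n \<ge> N \<Longrightarrow> (int n - d u (r n) = height u \<and> int n - d v (r n) = height v) \<and>
     (int n - d (\<gamma> u) (r n) = height (\<gamma> u) \<and> int n - d (\<gamma> v) (r n) = height (\<gamma> v))"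
    by (auto simp: eventually_sequentially)
  define D where "D = d (\<gamma> (r 0)) (r 0)"
  have D0: "D \<ge> 0" unfolding D_def by (rule dist_nonneg)
  define m where "m = N + nat D + c + 1"
  have m: "int m = int N + D + int c + 1" using D0 by (simp add: m_def)
  obtain n where n: "d (\<gamma> (r m)) (r n) \<le> int c"
    using merge0[OF g, of 0 m] m D_def by auto
  note V = act[OF g r_in] act[OF g uv(1)] act[OF g uv(2)] r_in
  have "int m = d (\<gamma> (r m)) (\<gamma> (r 0))" using isometry[OF g r_in r_in] by (simp add: r_dist)
  also have "\<dots> \<le> d (\<gamma> (r m)) (r n) + d (r n) (\<gamma> (r 0))" by (intro dist_tri V)
  also have "d (r n) (\<gamma> (r 0)) \<le> d (r n) (r 0) + d (r 0) (\<gamma> (r 0))" by (intro dist_tri V)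
  also have "d (r 0) (\<gamma> (r 0)) = D" unfolding D_def by (intro dist_sym V)
  finally have nN: "n \<ge> N" using n m by (simp add: r_dist)
  have mN: "m \<ge> N" by (simp add: m_def)
  have 1: "\<bar>d (\<gamma> w) (r n) - d w (r m)\<bar> \<le> int c" if w: "w \<in> V" for w
    using dist_tri[OF act[OF g w] V(1)[of m] V(4)[of n]] isometry[OF g w V(4)[of m]] n
      dist_tri[OF act[OF g w] V(4)[of n] V(1)[of m]] dist_sym[OF V(1)[of m] V(4)[of n]] by simp
  show ?thesis using 1[OF uv(1)] 1[OF uv(2)] N[OF nN] N[OF mN] by linarith
qed

end

text \<open>If \<open>g\<close> moves \<open>r 0\<close> by \<open>2 * h\<close>, points of
  \<open>r\<close> are within \<open>h + 2 * c\<close> of the axis, and nearness gets the radius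
  \<open>h + 4 * c\<close>. One step has to outweigh this radius plus \<open>2 * c\<close>, so
  \<open>h = 6 * c + 1\<close> is the least choice.\<close>

locale focal_axis = focal_action +
  fixes g :: "'a \<Rightarrow> 'a"
  assumes g_in: "g \<in> \<Gamma>" and g_shift: "g (r 0) = r (12 * c + 2)"
begin

section \<open>The coarse axis of \<open>g\<close>\<close>

definition shift :: "int \<Rightarrow> 'a \<Rightarrow> 'a" where "shift j = g [^]\<^bsub>BijGroup V\<^esub> j"

definition axis :: "int \<Rightarrow> 'a" where "axis j = shift j (r 0)"

definition step :: int where "step = 12 * int c + 2"

lemma g_carrier: "g \<in> carrier (BijGroup V)"
  using g_in subgroup.subset[OF subgroup] by auto

lemma shift_in: "shift j \<in> \<Gamma>"
  unfolding shift_def using group.subgroup_int_pow_closed[OF group_BijGroup subgroup g_in] .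

lemma shift_0: "u \<in> V \<Longrightarrow> shift 0 u = u"
  by (simp add: shift_def one_act)

lemma shift_1: "shift 1 = g"
  unfolding shift_def using group.int_pow_1[OF group_BijGroup g_carrier] .

lemma shift_add:
  assumes "u \<in> V" shows "shift (i + j) u = shift i (shift j u)"
proof -
  have "shift (i + j) = shift i \<odot> shift j"
    unfolding shift_def by (rule group.int_pow_mult[OF group_BijGroup g_carrier])
  then show ?thesis using mul_act[OF shift_in shift_in assms] by simp
qed

lemma axis_in [simp]: "axis j \<in> V" by (simp add: axis_def shift_in)

lemma shift_axis: "shift i (axis j) = axis (i + j)"
  by (simp add: axis_def shift_add)

lemma axis_0: "axis 0 = r 0" by (simp add: axis_def shift_0)

lemma axis_Suc: "axis (j + 1) = shift j (r (12 * c + 2))"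
  by (simp add: axis_def shift_add shift_1 g_shift)

lemma axis_dist_Suc: "d (axis j) (axis (j + 1)) = step"
  using isometry[OF shift_in[of j] r_in[of 0] r_in[of "12 * c + 2"]]
  unfolding axis_Suc axis_def[of j] by (simp add: r_dist step_def)

text \<open>Consecutive axis points are the ends of a shifted segment of \<open>r\<close> of length
  \<open>12 * c + 2\<close>, and quasi-invariance loses at most \<open>2 * c\<close> of its climb.
  The loss is per step, so the axis climbs at least linearly.\<close>

lemma axis_height_step:
  "height (axis j) + 10 * int c + 2 \<le> height (axis (j + 1))"
  "height (axis (j + 1)) \<le> height (axis j) + step"
proof -
  show "height (axis j) + 10 * int c + 2 \<le> height (axis (j + 1))"
    using height_quasi_invariant[OF shift_in[of j] r_in[of 0] r_in[of "12 * c + 2"]] axis_Suc[of j]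
    by (simp add: height_r axis_def[of j])
  show "height (axis (j + 1)) \<le> height (axis j) + step"
    using height_lipschitz[OF axis_in[of j] axis_in[of "j + 1"]] by (simp add: axis_dist_Suc)
qed

lemma axis_height_add:
  "height (axis i) + int n * (10 * int c + 2) \<le> height (axis (i + int n))"
  "height (axis (i + int n)) \<le> height (axis i) + int n * step"
proof (induction n)
  case (Suc n)
  have e: "i + int (Suc n) = (i + int n) + 1" by simp
  { case 1 show ?case using Suc.IH(1) axis_height_step(1)[of "i + int n"] unfolding e
      by (simp add: algebra_simps) }
  { case 2 show ?case using Suc.IH(2) axis_height_step(2)[of "i + int n"] unfolding e
      by (simp add: algebra_simps) }
qed auto

lemma axis_height_le:
  assumes "i \<le> j"
  shows "height (axis i) + (j - i) \<le> height (axis j)" "height (axis j) \<le> height (axis i) + (j - i) * step"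
proof -
  define n where "n = nat (j - i)"
  have j: "j = i + int n" using assms by (simp add: n_def)
  have "int n * 1 \<le> int n * (10 * int c + 2)" by (intro mult_left_mono) auto
  then show "height (axis i) + (j - i) \<le> height (axis j)" 
    using axis_height_add(1)[of i n] unfolding j by simp
  show "height (axis j) \<le> height (axis i) + (j - i) * step"
    using axis_height_add(2)[of i n] unfolding j by simp
qed

lemma height_axis_0: "height (axis 0) = 0" by (simp add: axis_0 height_r)

lemma axis_dist: "d (axis i) (axis j) \<le> \<bar>i - j\<bar> * step"
proof -
  have *: "d (axis i) (axis (i + int n)) \<le> int n * step" for i n
  proof (induction n)
    case (Suc n)
    have "d (axis i) (axis (i + int n + 1)) \<le> int n * step + step"
      using Suc dist_tri[OF axis_in[of i] axis_in[of "i + int n"] axis_in[of "i + int n + 1"]]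
        axis_dist_Suc[of "i + int n"] by linarith
    moreover have "i + int (Suc n) = i + int n + 1" "int (Suc n) * step = int n * step + step"
      by (simp_all add: distrib_right)
    ultimately show ?case by metis
  qed (simp add: dist_self)
  show ?thesis
  proof (cases "i \<le> j")
    case True
    then show ?thesis using *[of i "nat (j - i)"] by simp
  next
    case False
    then show ?thesis using *[of j "nat (i - j)"] dist_sym[OF axis_in axis_in, of i j] by simp
  qed
qed

text \<open>Errors do not accumulate: starting within \<open>c\<close> of \<open>r\<close>, the
  shifted ray is again within \<open>c\<close> of \<open>r\<close> after \<open>12 * c + 2\<close>
  steps, since this exceeds \<open>2 * c\<close>.\<close>

lemma axis_near_r: "\<exists>m. d (axis (int j)) (r m) \<le> int c"
proof (induction j)
  case 0
  then show ?case using dist_self[of "r 0"] by (intro exI[of _ 0]) (simp add: axis_0)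
next
  case (Suc j)
  then obtain m where m: "d (axis (int j)) (r m) \<le> int c" by auto
  have "\<exists>m'. d (shift (int j) (r (12 * c + 2))) (r m') \<le> int c"
    using m by (intro merge0[OF shift_in, where t = m]) (simp add: axis_def)
  moreover have "shift (int j) (r (12 * c + 2)) = axis (int (Suc j))"
    unfolding axis_Suc[symmetric] by (simp add: add.commute)
  ultimately show ?case by simp
qed

lemma r_near_axis: "\<exists>j. d (r n) (axis j) \<le> 8 * int c + 1"
proof -
  have "\<exists>j. height (axis j) \<le> int n \<and> int n < height (axis (j + 1)) \<and> j \<ge> 0"
  proof -
    have ex: "height (axis (int (Suc n))) > int n"
      using axis_height_le(1)[of 0 "int (Suc n)"] height_axis_0 by simp
    define i where "i = (LEAST i. height (axis (int i)) > int n)"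
    have i: "height (axis (int i)) > int n" unfolding i_def using ex by (rule LeastI)
    then have i0: "i \<noteq> 0" using height_axis_0 by (intro notI) simp
    then have "\<not> height (axis (int (i - 1))) > int n"
      unfolding i_def using not_less_Least i_def by (metis diff_less not_gr_zero zero_less_one)
    then show ?thesis using i i0 by (intro exI[of _ "int (i - 1)"]) (auto simp: of_nat_diff)
  qed
  then obtain j where j: "height (axis j) \<le> int n" "int n < height (axis (j + 1))" "j \<ge> 0" by auto
  \<comment> \<open>Replacing the axis point by a point of \<open>r\<close> turns a difference in
    height into a distance, up to \<open>2 * c\<close>.\<close>
  have near: "d (r n) (axis i) \<le> \<bar>height (axis i) - int n\<bar> + 2 * int c" if i: "i \<ge> 0" for i
  proof -
    obtain m where m: "d (axis i) (r m) \<le> int c" using axis_near_r[of "nat i"] i by auto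
    then have "\<bar>height (axis i) - int m\<bar> \<le> int c"
      using height_lipschitz[OF axis_in[of i] r_in[of m]] by (simp add: height_r)
    then show ?thesis using m dist_tri[OF r_in[of n] r_in[of m] axis_in[of i]] 
        dist_sym[OF r_in[of m] axis_in[of i]] r_dist[of n m] by linarith
  qed
  show ?thesis
  proof (cases "int n - height (axis j) \<le> 6 * int c + 1")
    case True
    then show ?thesis using near[of j] j by (intro exI[of _ j]) linarith
  next
    case False
    then have "height (axis (j + 1)) - int n \<le> 6 * int c + 1"
      using axis_height_step(2)[of j] by (simp add: step_def)
    then show ?thesis using near[of "j + 1"] j by (intro exI[of _ "j + 1"]) linarith
  qed
qed

text \<open>Consecutive axis points are \<open>12 * c + 2\<close> apart, so a point of \<open>r\<close> is within
  \<open>(6 * c + 1) + 2 * c\<close> of the axis; merging with a ray along the axis costs another \<open>2 * c\<close>.\<close>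

definition near :: "'a \<Rightarrow> bool" where "near v \<longleftrightarrow> (\<exists>j. d v (axis j) \<le> 10 * int c + 1)"

lemma near_shift:
  assumes "near v" "v \<in> V" shows "near (shift j v)"
proof -
  obtain i where "d v (axis i) \<le> 10 * int c + 1" using assms by (auto simp: near_def)
  then have "d (shift j v) (axis (j + i)) \<le> 10 * int c + 1"
    using isometry[OF shift_in[of j] assms(2) axis_in[of i]] by (simp add: shift_axis)
  then show ?thesis by (auto simp: near_def)
qed

text \<open>Both lines run to the same boundary point, so whatever their distance, they are near
  with a fixed constant after climbing more than this distance plus \<open>2 * c\<close>: one
  \<open>c\<close> for exchanging \<open>axis (int p)\<close> for \<open>r m\<close>, one for
  merging.\<close>

lemma near_improve:
  assumes g: "\<gamma> \<in> \<Gamma>" and dist: "d (\<gamma> (axis i)) (axis j) + 2 * int c < height (axis (int p))"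
  shows "near (\<gamma> (axis (i + int p)))"
proof -
  obtain m where m: "d (axis (int p)) (r m) \<le> int c" using axis_near_r by auto
  have hm: "height (axis (int p)) - int c \<le> int m"
    using m height_lipschitz[OF axis_in[of "int p"] r_in[of m]] by (simp add: height_r)
  define \<gamma>' where "\<gamma>' = \<gamma> \<odot> shift i"
  have g': "\<gamma>' \<in> \<Gamma>" unfolding \<gamma>'_def using g shift_in by (rule mul_closed)
  have g'_act: "\<gamma>' u = \<gamma> (shift i u)" if "u \<in> V" for u
    unfolding \<gamma>'_def using g shift_in that by (rule mul_act)
  have "\<exists>m'. d (\<gamma>' (r m)) (shift j (r m')) \<le> int c"
    using dist hm by (intro merge[OF g' shift_in, where t = 0]) (simp add: g'_act flip: axis_def)
  then obtain m' where m': "d (\<gamma>' (r m)) (shift j (r m')) \<le> int c" by auto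
  obtain q where q: "d (r m') (axis q) \<le> 8 * int c + 1" using r_near_axis by auto
  have e: "\<gamma> (axis (i + int p)) = \<gamma>' (axis (int p))" by (simp add: g'_act shift_axis)
  have 1: "d (\<gamma>' (axis (int p))) (\<gamma>' (r m)) \<le> int c" using m isometry[OF g'] by simp
  have 2: "d (shift j (r m')) (axis (j + q)) \<le> 8 * int c + 1"
    using q isometry[OF shift_in r_in axis_in, of j m' q] by (simp add: shift_axis)
  note V = act[OF g' axis_in] act[OF g' r_in] act[OF shift_in r_in] axis_in
  have "d (\<gamma>' (axis (int p))) (axis (j + q)) \<le> d (\<gamma>' (axis (int p))) (\<gamma>' (r m)) + d (\<gamma>' (r m)) (axis (j + q))"
    by (intro dist_tri V)
  also have "d (\<gamma>' (r m)) (axis (j + q)) \<le> d (\<gamma>' (r m)) (shift j (r m')) + d (shift j (r m')) (axis (j + q))"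
    by (intro dist_tri V)
  finally show ?thesis using 1 2 m' unfolding near_def e by (intro exI[of _ "j + q"]) linarith
qed

section \<open>The companions of the axis\<close>

text \<open>By \<open>near_improve\<close> with one step, nearness at \<open>axis (- int n)\<close>
  persists at all later axis points. The witness \<open>\<gamma>\<close> need not be determined by
  the vertex, as stabilisers may be nontrivial.\<close>

definition companions :: "nat \<Rightarrow> 'a set" where
  "companions n = {\<gamma> (r 0) | \<gamma>. \<gamma> \<in> \<Gamma> \<and> near (\<gamma> (axis (- int n)))}"

lemma companions_V: "companions n \<subseteq> V"
  by (auto simp: companions_def)

lemma companions_Suc: "companions (Suc n) \<subseteq> companions n"
proof
  fix v assume "v \<in> companions (Suc n)"
  then obtain \<gamma> j where v: "v = \<gamma> (r 0)" "\<gamma> \<in> \<Gamma>" "d (\<gamma> (axis (- int (Suc n)))) (axis j) \<le> 10 * int c + 1"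
    by (auto simp: companions_def near_def)
  \<comment> \<open>The length of a step is made for this:
    \<open>(10 * c + 1) + 2 * c < 12 * c + 2\<close>.\<close>
  have "height (axis (int 1)) = 12 * int c + 2"
    using axis_Suc[of 0] by (simp add: shift_0 height_r)
  then have "near (\<gamma> (axis (- int (Suc n) + int 1)))"
    using v(3) by (intro near_improve[OF v(2), of _ j]) linarith
  moreover have "- int (Suc n) + int 1 = - int n" by simp
  ultimately show "v \<in> companions n" using v by (auto simp: companions_def)
qed

lemma companions_antimono: "m \<le> n \<Longrightarrow> companions n \<subseteq> companions m"
  by (rule lift_Suc_antimono_le[of companions]) (use companions_Suc in auto)

lemma companions_near:
  assumes "v \<in> companions n" shows "near v"
proof -
  have "v \<in> companions 0" using companions_antimono[of 0 n] assms by auto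
  then show ?thesis by (auto simp: companions_def axis_0)
qed

lemma companions_shift:
  assumes "v \<in> companions n" shows "shift j v \<in> companions n"
proof -
  obtain \<gamma> where \<gamma>: "\<gamma> \<in> \<Gamma>" "v = \<gamma> (r 0)" "near (\<gamma> (axis (- int n)))"
    using assms by (auto simp: companions_def)
  have "shift j \<odot> \<gamma> \<in> \<Gamma>" using \<gamma> shift_in by (intro mul_closed)
  moreover have "(shift j \<odot> \<gamma>) u = shift j (\<gamma> u)" if "u \<in> V" for u
    using \<gamma> shift_in that by (intro mul_act)
  ultimately show ?thesis unfolding companions_def using \<gamma> near_shift[OF \<gamma>(3)]
    by (intro CollectI exI[of _ "shift j \<odot> \<gamma>"]) auto
qed

lemma axis_companion: "axis j \<in> companions n"
proof -
  have "near (axis (j + - int n))"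
    unfolding near_def using dist_self[OF axis_in, of "j + - int n"] by (intro exI[of _ "j + - int n"]) simp
  then show ?thesis unfolding companions_def
    by (intro CollectI exI[of _ "shift j"]) (auto simp: shift_in axis_def[symmetric] shift_axis)
qed

text \<open>The sets \<open>companions n\<close> decrease and are unions of translates of their finite parts
  around \<open>r 0\<close>, so they stabilise.\<close>

lemma companions_stable: "\<exists>n. companions (n + 2) = companions n"
proof -
  define B where "B n = companions n \<inter> {v \<in> V. d (r 0) v \<le> 10 * int c + 1}" for n
  have fin: "finite (B n)" for n unfolding B_def using finite_ball[OF r_in] by blast
  obtain n where n: "\<And>m. card (B n) \<le> card (B m)"
    using ex_has_least_nat[of "\<lambda>_. True" _ "\<lambda>n. card (B n)"] by auto
  have "B (n + 2) \<subseteq> B n" using companions_antimono[of n "n + 2"] by (auto simp: B_def)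
  then have eq: "B (n + 2) = B n" using n[of "n + 2"] fin by (intro card_seteq) auto
  have "companions n \<subseteq> companions (n + 2)"
  proof
    fix v assume v: "v \<in> companions n"
    then obtain j where j: "d v (axis j) \<le> 10 * int c + 1"
      using companions_near[OF v] by (auto simp: near_def)
    have vV: "v \<in> V" using v companions_V by auto
    have "d (shift (-j) v) (axis 0) \<le> 10 * int c + 1"
      using j isometry[OF shift_in vV axis_in, of "-j" j] by (simp add: shift_axis)
    then have "shift (-j) v \<in> B n"
      unfolding B_def using companions_shift[OF v] dist_sym[OF act[OF shift_in vV] axis_in, of "-j" 0]
      by (simp add: axis_0 shift_in vV)
    then have "shift (-j) v \<in> companions (n + 2)" unfolding eq[symmetric] by (auto simp: B_def)
    then have "shift j (shift (-j) v) \<in> companions (n + 2)" by (rule companions_shift)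
    then show "v \<in> companions (n + 2)" by (simp add: vV shift_0 flip: shift_add)
  qed
  then show ?thesis using companions_antimono[of n "n + 2"] by auto
qed

text \<open>Two levels are compared because in \<open>A_translate\<close> one more group element
  spoils nearness, and two axis steps repair it.\<close>

definition rank :: nat where "rank = (SOME n. companions (n + 2) = companions n)"

abbreviation "A \<equiv> companions rank"

lemma A_stable: "companions (rank + 2) = A"
  unfolding rank_def by (rule someI_ex[OF companions_stable])

text \<open>By stability \<open>v\<close> has a witness \<open>\<eta>\<close> that is near the axis
  already two steps deeper. If \<open>v\<close> is high, so is the axis point met there, and at that
  height \<open>\<gamma>\<close> keeps \<open>r\<close> close to itself. The constant gets worse,
  but \<open>near_improve\<close> restores it two steps up.\<close>

lemma A_translate:
  obtains K where "0 \<le> K"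
    "\<And>\<gamma> v. \<gamma> \<in> \<Gamma> \<Longrightarrow> d (\<gamma> (r 0)) (r 0) \<le> 1 \<Longrightarrow> v \<in> A \<Longrightarrow> K \<le> height v \<Longrightarrow> \<gamma> v \<in> A"
proof
  \<comment> \<open>With \<open>q \<le> j\<close>, the point \<open>r m\<close> close to
    \<open>axis j\<close> has \<open>m > c + 1\<close>, as merging for \<open>\<gamma>\<close>
    needs. \<open>K\<close> adds the greatest possible drop in height from \<open>v\<close> to
    \<open>axis j\<close>, and one for strictness.\<close>
  define q where "q = 2 * int c + 2"
  define K where "K = q * step + (int rank + 2) * step + 10 * int c + 2"
  show "0 \<le> K" by (simp add: K_def q_def step_def)
  fix \<gamma> v assume \<gamma>: "\<gamma> \<in> \<Gamma>" "d (\<gamma> (r 0)) (r 0) \<le> 1" and v: "v \<in> A" and K: "K \<le> height v"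
  define n where "n = int (rank + 2)"
  obtain \<eta> j where \<eta>: "\<eta> \<in> \<Gamma>" "v = \<eta> (r 0)" and j: "d (\<eta> (axis (- n))) (axis j) \<le> 10 * int c + 1"
    using v A_stable unfolding companions_def near_def n_def by blast
  note \<eta>V = act[OF \<eta>(1) axis_in]
  have "q \<le> j"
  proof (rule ccontr)
    assume "\<not> q \<le> j"
    then have "height (axis j) \<le> height (axis q)" using axis_height_le(1)[of j q] by simp
    also have "\<dots> \<le> q * step" using axis_height_le(2)[of 0 q] height_axis_0 by (simp add: q_def)
    finally have 1: "height (axis j) \<le> q * step" .
    have "d (\<eta> (axis (- n))) (\<eta> (axis 0)) \<le> n * step"
      using axis_dist[of "- n" 0] unfolding isometry[OF \<eta>(1) axis_in axis_in] by (simp add: n_def add.commute)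
    then have "height v \<le> height (\<eta> (axis (- n))) + n * step"
      using height_lipschitz[OF \<eta>V[of "- n"] \<eta>V[of 0]] \<eta>(2) by (simp add: axis_0)
    moreover have "height (\<eta> (axis (- n))) \<le> height (axis j) + 10 * int c + 1"
      using height_lipschitz[OF \<eta>V[of "- n"] axis_in[of j]] j by simp
    moreover have "n * step = (int rank + 2) * step" by (simp add: n_def)
    ultimately show False using 1 K unfolding K_def by linarith
  qed
  then have j0: "j = int (nat j)" "q \<le> j" by (auto simp: q_def)
  obtain m where m: "d (axis j) (r m) \<le> int c" using axis_near_r[of "nat j"] j0 by auto
  have "j \<le> height (axis j)" using axis_height_le(1)[of 0 j] height_axis_0 j0 by (simp add: q_def)
  then have "int c + 1 < int m"
    using m height_lipschitz[OF axis_in[of j] r_in[of m]] j0(2) by (simp add: height_r q_def)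
  then obtain m' where m': "d (\<gamma> (r m)) (r m') \<le> int c"
    using merge0[OF \<gamma>(1), of 0 m] \<gamma>(2) by auto
  obtain i where i: "d (r m') (axis i) \<le> 8 * int c + 1" using r_near_axis by auto
  note \<gamma>V = act[OF \<gamma>(1)]
  have "d (\<gamma> (\<eta> (axis (- n)))) (axis i) \<le> d (\<gamma> (\<eta> (axis (- n)))) (\<gamma> (axis j)) + d (\<gamma> (axis j)) (axis i)"
    by (intro dist_tri \<gamma>V[OF \<eta>V] \<gamma>V[OF axis_in] axis_in)
  moreover have "d (\<gamma> (axis j)) (axis i) \<le> d (\<gamma> (axis j)) (\<gamma> (r m)) + d (\<gamma> (r m)) (axis i)"
    by (intro dist_tri \<gamma>V[OF r_in] \<gamma>V[OF axis_in] r_in axis_in)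
  moreover have "d (\<gamma> (r m)) (axis i) \<le> d (\<gamma> (r m)) (r m') + d (r m') (axis i)"
    by (intro dist_tri \<gamma>V[OF r_in] \<gamma>V[OF axis_in] r_in axis_in)
  \<comment> \<open>The sum of \<open>10 * c + 1\<close> for \<open>\<eta>\<close>, \<open>c\<close>
    from \<open>axis j\<close> to \<open>r m\<close>, \<open>c\<close> for merging, and
    \<open>8 * c + 1\<close> back to the axis.\<close>
  ultimately have "d ((\<gamma> \<odot> \<eta>) (axis (- n))) (axis i) \<le> 20 * int c + 2"
    unfolding mul_act[OF \<gamma>(1) \<eta>(1) axis_in]
    using i m' m j isometry[OF \<gamma>(1) \<eta>V axis_in, of "- n" j] isometry[OF \<gamma>(1) axis_in r_in, of j m]
    by linarith
  moreover have "22 * int c + 4 \<le> height (axis (int 2))"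
  proof -
    have "height (axis 1) = 12 * int c + 2" using axis_Suc[of 0] by (simp add: shift_0 height_r)
    then show ?thesis using axis_height_step(1)[of 1] by simp
  qed
  ultimately have "near ((\<gamma> \<odot> \<eta>) (axis (- n + int 2)))"
    by (intro near_improve[OF mul_closed[OF \<gamma>(1) \<eta>(1)], of _ i]) linarith
  moreover have "- n + int 2 = - int rank" by (simp add: n_def)
  ultimately show "\<gamma> v \<in> A"
    unfolding companions_def \<eta>(2) using mul_closed[OF \<gamma>(1) \<eta>(1)] mul_act[OF \<gamma>(1) \<eta>(1) r_in, of 0]
    by (intro CollectI exI[of _ "\<gamma> \<odot> \<eta>"]) auto
qed

text \<open>The invariant along a path of low height: for \<open>p = \<eta> (r 0)\<close>, the part of \<open>\<eta> A\<close> above a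
  fixed height lies in \<open>A\<close>.\<close>

theorem separation:
  obtains P R where
    "\<And>u v. u \<in> V \<Longrightarrow> v \<in> V \<Longrightarrow> d u v \<le> 1 \<Longrightarrow> R < d u (r 0) \<Longrightarrow> R < d v (r 0) \<Longrightarrow> P u \<Longrightarrow> P v"
    "\<And>n. n > 0 \<Longrightarrow> \<not> P (r n)"
    "\<exists>w :: nat \<Rightarrow> 'a. (\<forall>n. w n \<in> V \<and> d (w n) (w (Suc n)) = 1) \<and>
      (\<forall>\<^sub>F n in sequentially. P (w n)) \<and> (\<forall>v. finite {n. w n = v})"
proof -
  obtain K where K0: "0 \<le> K" and K: "\<And>\<gamma> v. \<gamma> \<in> \<Gamma> \<Longrightarrow> d (\<gamma> (r 0)) (r 0) \<le> 1 \<Longrightarrow> v \<in> A \<Longrightarrow>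
      K \<le> height v \<Longrightarrow> \<gamma> v \<in> A" using A_translate by blast
  \<comment> \<open>The extra \<open>2 * c\<close> pays for quasi-invariance: if
    \<open>\<theta> (r 0)\<close> has height at most \<open>0\<close> and \<open>\<theta> v\<close>
    height at least \<open>K'\<close>, then \<open>v\<close> has height at least
    \<open>K\<close>.\<close>
  define K' where "K' = K + 2 * int c"
  define good where "good p \<longleftrightarrow> (\<exists>\<eta>\<in>\<Gamma>. \<eta> (r 0) = p \<and> (\<forall>v\<in>A. K' \<le> height (\<eta> v) \<longrightarrow> \<eta> v \<in> A))" for p
  have good_step: "good q" if good: "good p" and q: "q \<in> V" "d p q \<le> 1" "height q \<le> 0" for p q
  proof -
    obtain \<eta> where \<eta>: "\<eta> \<in> \<Gamma>" "\<eta> (r 0) = p" "\<And>v. v \<in> A \<Longrightarrow> K' \<le> height (\<eta> v) \<Longrightarrow> \<eta> v \<in> A"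
      using good unfolding good_def by auto
    obtain \<theta> where \<theta>: "\<theta> \<in> \<Gamma>" "\<theta> (r 0) = q" using transitive[OF r_in q(1)] by auto
    obtain \<iota> where \<iota>: "\<iota> \<in> \<Gamma>" "\<And>u. u \<in> V \<Longrightarrow> \<iota> (\<eta> u) = u" "\<And>u. u \<in> V \<Longrightarrow> \<eta> (\<iota> u) = u"
      using inverse_in[OF \<eta>(1)] by auto
    \<comment> \<open>\<open>\<tau>\<close> moves \<open>r 0\<close> by at most 1, so
      \<open>A_translate\<close> applies to it, and \<open>\<theta> v = \<eta> (\<tau> v)\<close>
      inherits the property of \<open>\<eta>\<close>.\<close>
    define \<tau> where "\<tau> = \<iota> \<odot> \<theta>"
    have \<tau>: "\<tau> \<in> \<Gamma>" "\<And>u. u \<in> V \<Longrightarrow> \<tau> u = \<iota> (\<theta> u)"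
      unfolding \<tau>_def using \<iota> \<theta> by (auto intro: mul_closed mul_act)
    have pV: "p \<in> V" using act[OF \<eta>(1) r_in] \<eta>(2) by auto
    have "d (\<tau> (r 0)) (r 0) = d (\<iota> q) (\<iota> p)" using \<tau>(2) \<theta>(2) \<iota>(2)[OF r_in] \<eta>(2) by auto
    also have "\<dots> = d q p" by (rule isometry[OF \<iota>(1) q(1) pV])
    finally have t: "d (\<tau> (r 0)) (r 0) \<le> 1" using q dist_sym[OF pV q(1)] by simp
    have "\<theta> v \<in> A" if v: "v \<in> A" "K' \<le> height (\<theta> v)" for v
    proof -
      have vV: "v \<in> V" using v companions_V by auto
      have "K \<le> height v"
        using height_quasi_invariant[OF \<theta>(1) vV r_in[of 0]] v(2) \<theta>(2) q(3) by (simp add: K'_def height_r)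
      then have "\<tau> v \<in> A" using K[OF \<tau>(1) t v(1)] by simp
      then show ?thesis using \<eta>(3)[of "\<tau> v"] v \<tau>(2)[OF vV] \<iota>(3)[OF act[OF \<theta>(1) vV]] by simp
    qed
    with \<theta> show ?thesis unfolding good_def by blast
  qed
  \<comment> \<open>\<open>j\<close> lets \<open>\<eta> (axis j)\<close> reach height
    \<open>K'\<close> when \<open>height p = 0\<close>. \<open>M\<close> bounds the way from
    \<open>p\<close> through \<open>\<eta> (axis j)\<close> to an axis point and also the index of
    that point, whose distance from \<open>r 0\<close> is then at most
    \<open>M * step\<close>.\<close>
  define j where "j = K' + 2 * int c"
  define M where "M = j * step + 10 * int c + 1"
  define R where "R = M + M * step"
  \<comment> \<open>Since \<open>axis j\<close> is in \<open>A\<close>, its image under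
    \<open>\<eta>\<close> is in \<open>A\<close> too, hence near the axis at bounded height.\<close>
  have good_bound: "d p (r 0) \<le> R" if good: "good p" and p: "height p = 0" for p
  proof -
    obtain \<eta> where \<eta>: "\<eta> \<in> \<Gamma>" "\<eta> (r 0) = p" "\<And>v. v \<in> A \<Longrightarrow> K' \<le> height (\<eta> v) \<Longrightarrow> \<eta> v \<in> A"
      using good unfolding good_def by auto
    have pV: "p \<in> V" using act[OF \<eta>(1) r_in] \<eta>(2) by auto
    have j: "0 \<le> j" "0 \<le> K'" using K0 by (auto simp: j_def K'_def)
    have "j \<le> height (axis j)" using axis_height_le(1)[of 0 j] height_axis_0 j by simp
    then have h: "K' \<le> height (\<eta> (axis j))"
      using height_quasi_invariant[OF \<eta>(1) axis_in[of j] r_in[of 0]] \<eta>(2) p by (simp add: height_r j_def)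
    then have "near (\<eta> (axis j))" using \<eta>(3)[OF axis_companion] companions_near by blast
    then obtain m where m: "d (\<eta> (axis j)) (axis m) \<le> 10 * int c + 1" unfolding near_def by auto
    have e: "d p (\<eta> (axis j)) \<le> j * step"
      using axis_dist[of 0 j] isometry[OF \<eta>(1) r_in[of 0] axis_in[of j]] \<eta>(2) j by (simp add: axis_0)
    then have "height (\<eta> (axis j)) \<le> j * step"
      using height_lipschitz[OF pV act[OF \<eta>(1) axis_in[of j]]] p by simp
    then have "\<bar>height (axis m)\<bar> \<le> M"
      using height_lipschitz[OF act[OF \<eta>(1) axis_in[of j]] axis_in[of m]] m h j unfolding M_def by linarith
    then have "\<bar>m\<bar> \<le> M"
      using axis_height_le(1)[of 0 m] axis_height_le(1)[of m 0] height_axis_0 by linarith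
    then have "\<bar>m\<bar> * step \<le> M * step" by (intro mult_right_mono) (auto simp: step_def)
    then have "d (axis m) (r 0) \<le> M * step" using axis_dist[of m 0] by (simp add: axis_0)
    moreover have "d p (r 0) \<le> d p (\<eta> (axis j)) + d (\<eta> (axis j)) (r 0)"
      by (intro dist_tri pV act[OF \<eta>(1) axis_in] r_in axis_in)
    moreover have "d (\<eta> (axis j)) (r 0) \<le> d (\<eta> (axis j)) (axis m) + d (axis m) (r 0)"
      by (intro dist_tri act[OF \<eta>(1) axis_in] r_in axis_in)
    ultimately show ?thesis using e m R_def M_def by linarith
  qed
  define P where "P v \<longleftrightarrow> good v \<and> height v \<le> 0" for v
  \<comment> \<open>A step changes the height by at most one, so leaving
    \<open>height \<le> 0\<close> requires a good vertex of height \<open>0\<close>, and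
    \<open>good_bound\<close> confines these to the ball.\<close>
  have 1: "P v" if "u \<in> V" "v \<in> V" "d u v \<le> 1" "R < d u (r 0)" "R < d v (r 0)" "P u" for u v
  proof -
    have "height v \<le> 0"
    proof (rule ccontr)
      assume "\<not> height v \<le> 0"
      then have "height u = 0" using that height_lipschitz[OF that(1,2)] by (simp add: P_def)
      then show False using good_bound[of u] that by (simp add: P_def)
    qed
    then show ?thesis using good_step[of u v] that by (simp add: P_def)
  qed
  have 2: "\<not> P (r n)" if "n > 0" for n using that by (simp add: P_def height_r)
  define k where "k = 12 * c + 2"
  have k: "k > 0" "step = int k" by (auto simp: k_def step_def)
  have below: "height (shift (- int j) (r i)) \<le> - int j + int i" for i j
  proof -
    have "d (shift (- int j) (r i)) (axis (- int j)) = int i"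
      unfolding axis_def using isometry[OF shift_in r_in r_in] by (simp add: r_dist)
    moreover have "height (axis (- int j)) \<le> - int j"
      using axis_height_le(1)[of "- int j" 0] height_axis_0 by simp
    ultimately show ?thesis
      using height_lipschitz[OF act[OF shift_in r_in] axis_in, of "- int j" i "- int j"] by simp
  qed
  \<comment> \<open>Shifts preserve \<open>A\<close>, so \<open>axis (- int j)\<close> is good; the
    shifted ray from there stays at height at most \<open>0\<close> for \<open>j\<close> steps, and
    goodness spreads along it.\<close>
  have P_below: "P (shift (- int j) (r i))" if "i \<le> j" for i j
    using that
  proof (induction i)
    case 0
    have "good (shift (- int j) (r 0))"
      unfolding good_def using shift_in companions_shift by (intro bexI[of _ "shift (- int j)"]) auto
    then show ?case using below[of j 0] by (simp add: P_def)
  next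
    case (Suc i)
    have "d (shift (- int j) (r i)) (shift (- int j) (r (Suc i))) = 1"
      using isometry[OF shift_in r_in r_in] by (simp add: r_dist)
    moreover have "height (shift (- int j) (r (Suc i))) \<le> 0" using below[of j "Suc i"] Suc by simp
    ultimately show ?case
      using good_step[of "shift (- int j) (r i)" "shift (- int j) (r (Suc i))"] Suc by (simp add: P_def shift_in)
  qed
  \<comment> \<open>A walk down the axis from \<open>r 0\<close>: each block of \<open>k\<close>
    indices runs backwards through one shifted segment of \<open>r\<close>, and \<open>r 0\<close>
    of one shift is \<open>r k\<close> of the next.\<close>
  define w where "w n = shift (- int (Suc (n div k))) (r (k - n mod k))" for n
  have wV: "w n \<in> V" for n by (simp add: w_def shift_in)
  have w_adj: "d (w n) (w (Suc n)) = 1" for n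
  proof (cases "Suc (n mod k) = k")
    case True
    then have s: "Suc n div k = Suc (n div k)" "Suc n mod k = 0"
      by (simp_all add: div_Suc mod_Suc)
    have "w (Suc n) = shift (- int (Suc (Suc (n div k)))) (r k)" unfolding w_def s by simp
    also have "\<dots> = axis (- int (Suc (Suc (n div k))) + 1)" unfolding axis_Suc by (simp add: k_def)
    also have "\<dots> = shift (- int (Suc (n div k))) (r 0)" by (simp add: axis_def)
    finally have e: "w (Suc n) = shift (- int (Suc (n div k))) (r 0)" .
    have "w n = shift (- int (Suc (n div k))) (r 1)" 
    proof -
      have "k - n mod k = 1" using True by linarith
      then show ?thesis unfolding w_def by simp
    qed
    then show ?thesis unfolding e using isometry[OF shift_in r_in r_in] by (simp add: r_dist)
  next
    case False
    then have s: "Suc n div k = n div k" "Suc n mod k = Suc (n mod k)"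
      by (simp_all add: div_Suc mod_Suc)
    have "n mod k < k" using k by simp
    then show ?thesis unfolding w_def s using isometry[OF shift_in r_in r_in] False
      by (simp add: r_dist of_nat_diff)
  qed
  \<comment> \<open>From \<open>k * k\<close> on, the number of shifts is at least the position
    \<open>k - n mod k\<close> in the segment, as \<open>P_below\<close> requires.\<close>
  have "P (w n)" if "k * k \<le> n" for n
  proof -
    have "k \<le> n div k" using that k by (simp add: less_eq_div_iff_mult_less_eq)
    then show ?thesis unfolding w_def by (intro P_below) simp
  qed
  then have w_P: "\<forall>\<^sub>F n in sequentially. P (w n)"
    by (intro eventually_sequentiallyI[of "k * k"]) simp
  \<comment> \<open>The height tends to minus infinity along the walk.\<close>
  have "finite {n. w n = v}" for v
  proof (rule finite_subset)
    show "{n. w n = v} \<subseteq> {..< k * Suc (nat (int k - height v))}"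
    proof
      fix n assume "n \<in> {n. w n = v}"
      then have "height v \<le> - int (Suc (n div k)) + int (k - n mod k)" 
        using below[of "Suc (n div k)" "k - n mod k"] by (auto simp: w_def)
      then have "n div k < Suc (nat (int k - height v))" by linarith
      then show "n \<in> {..< k * Suc (nat (int k - height v))}"
        using k by (simp add: less_mult_imp_div_less div_less_iff_less_mult mult.commute)
    qed
  qed simp
  then show thesis using that[of R P] 1 2 wV w_adj w_P by blast
qed

end


section \<open>One-ended hyperbolic graphs\<close>

lemma successively_invariant:
  assumes "successively R xs" "xs \<noteq> []"
    and "\<And>u v. u \<in> set xs \<Longrightarrow> v \<in> set xs \<Longrightarrow> R u v \<Longrightarrow> P u = P v"
  shows "P (hd xs) = P (last xs)"
  using assms
proof (induction xs rule: induct_list012)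
  case (3 x y xs)
  have "P (hd (y # xs)) = P (last (y # xs))"
    using 3 by (intro 3(2)) (auto simp: successively_Cons)
  moreover have "P x = P y" using 3(3,5) by simp
  ultimately show ?case by simp
qed auto

theorem theorem3p3:
  fixes V :: "'a set" and E :: "'a set set" and \<Gamma> :: "('a \<Rightarrow> 'a) set"
  assumes "simple_graph V E"
    and "locally_finite_graph V E"
    and "connected_graph V E"
    and "planar_graph V E"
    and "\<exists>!\<epsilon>. \<epsilon> \<in> graph_ends V E"
    and "hyperbolic_graph V E"
    and "automorphism_group_of V E \<Gamma>"
    and "vertex_transitive V \<Gamma>"
  shows "\<not> (\<exists>\<omega> \<in> hyperbolic_boundary V E. \<forall>g\<in>\<Gamma>. fixes_boundary_point g \<omega>)"
proof
  assume "\<exists>\<omega> \<in> hyperbolic_boundary V E. \<forall>g\<in>\<Gamma>. fixes_boundary_point g \<omega>"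
  then obtain \<omega> where \<omega>: "\<omega> \<in> hyperbolic_boundary V E" "\<And>g. g \<in> \<Gamma> \<Longrightarrow> fixes_boundary_point g \<omega>"
    by blast
  obtain r where r: "geodetic_ray V E r" and \<omega>_eq: "\<omega> = boundary_rel V E `` {r}"
    using \<omega>(1) by (auto simp: hyperbolic_boundary_def quotient_def)
  interpret locally_finite_connected V E
    using assms(1-3) by unfold_locales
  interpret bijection_group V \<Gamma>
    using assms(7) by (intro bijection_group.intro) (simp add: automorphism_group_of_def)
  have rV: "r n \<in> V" for n using r by (auto simp: geodetic_ray_def ray_def)
  have aut: "\<gamma> \<in> graph_automorphisms V E" if "\<gamma> \<in> \<Gamma>" for \<gamma>
    using assms(7) that by (auto simp: automorphism_group_of_def)
  \<comment> \<open>The class contains \<open>r\<close>, so every group element keeps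
    \<open>r\<close> in its own class; this also makes each translate a geodetic ray.\<close>
  have "r \<in> \<omega>" using boundary_rel_refl[OF r] by (simp add: \<omega>_eq)
  then have rel: "(r, \<gamma> \<circ> r) \<in> boundary_rel V E" if "\<gamma> \<in> \<Gamma>" for \<gamma>
    using \<omega>(2)[OF that] by (auto simp: fixes_boundary_point_def \<omega>_eq)
  then have geo: "geodetic_ray V E (\<gamma> \<circ> r)" if "\<gamma> \<in> \<Gamma>" for \<gamma>
    using that by (auto simp: boundary_rel_def)
  have iso: "gdist (\<gamma> u) (\<gamma> v) = gdist u v" if \<gamma>: "\<gamma> \<in> \<Gamma>" and uv: "u \<in> V" "v \<in> V" for \<gamma> u v
  proof -
    obtain \<eta> where "\<eta> \<in> \<Gamma>" "\<And>u. u \<in> V \<Longrightarrow> \<eta> (\<gamma> u) = u" using inverse_in[OF \<gamma>] by auto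
    then show ?thesis
      using gdist_automorphism_le[OF aut uv, of \<gamma>] \<gamma> uv
        gdist_automorphism_le[OF aut act act, of \<eta> \<gamma> u \<gamma> v] by fastforce
  qed
  obtain D where slim: "\<And>x y z P Q S u. geodesic V E x y P \<Longrightarrow> geodesic V E y z Q \<Longrightarrow>
      geodesic V E z x S \<Longrightarrow> u \<in> set P \<Longrightarrow> \<exists>w \<in> set Q \<union> set S. gdist u w \<le> D"
    using hyperbolic_slim[OF assms(6)] by metis
  have merge: "\<exists>m. gdist (\<gamma> (r n)) (\<eta> (r m)) \<le> 2 * D"
    if \<gamma>: "\<gamma> \<in> \<Gamma>" and \<eta>: "\<eta> \<in> \<Gamma>" and n: "gdist (\<gamma> (r 0)) (\<eta> (r t)) + 2 * D < n" for \<gamma> \<eta> t n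
  proof -
    obtain \<iota> where \<iota>: "\<iota> \<in> \<Gamma>" "\<And>u. u \<in> V \<Longrightarrow> \<gamma> (\<iota> u) = u" using inverse_in[OF \<gamma>] by auto
    \<comment> \<open>\<open>M\<close> depends on \<open>\<gamma>\<close> and \<open>\<eta>\<close>,
      but it only supplies the far away close pairs; the resulting bound \<open>2 * D\<close> is
      uniform.\<close>
    obtain M where M: "\<And>N. \<exists>n\<ge>N. \<exists>k. gdist (r n) ((\<iota> \<odot> \<eta> \<circ> r) k) \<le> M"
      using boundary_rel_dist[OF rel[OF mul_closed[OF \<iota>(1) \<eta>]]] by metis
    have "gdist (r n) ((\<iota> \<odot> \<eta> \<circ> r) k) = gdist ((\<gamma> \<circ> r) n) ((\<eta> \<circ> r) k)" for n k
      using iso[OF \<gamma> rV, of "\<iota> (\<eta> (r k))" n] act[OF \<iota>(1) act[OF \<eta> rV]] mul_act[OF \<iota>(1) \<eta> rV]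
        \<iota>(2)[OF act[OF \<eta> rV]] by simp
    then show ?thesis
      using rays_merge[OF slim geo[OF \<gamma>] geo[OF \<eta>], where M = M and t = t and n = n] M n by simp
  qed
  have trans: "\<exists>\<gamma>\<in>\<Gamma>. \<gamma> u = v" if "u \<in> V" "v \<in> V" for u v
    using assms(8) that unfolding vertex_transitive_def by blast
  obtain g where g: "g \<in> \<Gamma>" "g (r 0) = r (12 * (2 * D) + 2)"
    using trans[OF rV rV] by metis
  interpret focal_axis V \<Gamma> "\<lambda>u v. int (gdist u v)" r "2 * D" g
  proof unfold_locales
    show "finite {v \<in> V. int (gdist u v) \<le> R}" if "u \<in> V" for u R
      by (rule finite_subset[OF _ finite_gball[OF that, of "nat R"]]) auto
    show "\<exists>m. int (gdist (\<gamma> (r n)) (\<eta> (r m))) \<le> int (2 * D)"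
      if "\<gamma> \<in> \<Gamma>" "\<eta> \<in> \<Gamma>" "int (gdist (\<gamma> (r 0)) (\<eta> (r t))) + int (2 * D) < int n" for \<gamma> \<eta> t n
    proof -
      have "gdist (\<gamma> (r 0)) (\<eta> (r t)) + 2 * D < n" using that(3) by linarith
      then obtain m where "gdist (\<gamma> (r n)) (\<eta> (r m)) \<le> 2 * D" using merge[OF \<open>\<gamma> \<in> \<Gamma>\<close> \<open>\<eta> \<in> \<Gamma>\<close>] by blast
      then show ?thesis by (intro exI[of _ m]) linarith
    qed
    show "int (gdist u v) = int (gdist v u)" if "u \<in> V" "v \<in> V" for u v
      using gdist_sym[OF that] by simp
    show "int (gdist u w) \<le> int (gdist u v) + int (gdist v w)" if "u \<in> V" "v \<in> V" "w \<in> V" for u v w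
      using gdist_triangle[OF that] by simp
  qed (simp_all add: gdist_self iso trans rV geodetic_ray_dist[OF r] g)
  obtain P R w where P: "\<And>u v. u \<in> V \<Longrightarrow> v \<in> V \<Longrightarrow> int (gdist u v) \<le> 1 \<Longrightarrow>
        R < int (gdist u (r 0)) \<Longrightarrow> R < int (gdist v (r 0)) \<Longrightarrow> P u \<Longrightarrow> P v"
    and P_r: "\<And>n. n > 0 \<Longrightarrow> \<not> P (r n)"
    and w: "\<And>n. w n \<in> V" "\<And>n. gdist (w n) (w (Suc n)) = 1"
    and P_w: "\<forall>\<^sub>F n in sequentially. P (w n)" and fin: "\<And>v. finite {n. w n = v}"
    by (rule separation) (metis of_nat_eq_1_iff)
  \<comment> \<open>Ends are classes of injective rays, so the walk is loop-erased; along the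
    subsequence \<open>P\<close> still holds eventually.\<close>
  obtain f where f: "strict_mono f" and ray: "ray V E (\<lambda>i. w (f i))"
    using ray_of_walk[OF adj_if_gdist_1[OF w(1) w(1) w(2)] fin] by metis
  \<comment> \<open>Outside this ball all vertices are more than \<open>R\<close> away from
    \<open>r 0\<close>, so \<open>P\<close> is constant on each component.\<close>
  define S where "S = {v \<in> V. gdist (r 0) v \<le> nat R}"
  have "finite S" unfolding S_def by (rule finite_gball[OF rV])
  then obtain C where C: "C \<in> components_minus V E S" "\<forall>\<^sub>F n in sequentially. w (f n) \<in> C"
      "\<forall>\<^sub>F n in sequentially. r n \<in> C"
  proof -
    have "S \<subseteq> V" by (auto simp: S_def)
    moreover have "ray V E r" using r by (simp add: geodetic_ray_def)
    ultimately show ?thesis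
      using one_end_rel[OF assms(5) ray, of r] \<open>finite S\<close> that unfolding end_rel_def by blast
  qed
  then obtain x where x: "C = {y. \<exists>xs. graph_path (V - S) E x y xs}"
    by (auto simp: components_minus_def)
  have invariant: "P x = P y" if y: "y \<in> C" for y
  proof -
    obtain xs where xs: "graph_path (V - S) E x y xs" using y x by blast
    have far: "R < int (gdist u (r 0))" if "u \<in> set xs" for u
      using xs that gdist_sym[OF _ rV, of u 0] by (auto simp: graph_path_def S_def)
    have "P u = P v" if "u \<in> set xs" "v \<in> set xs" "adj u v" for u v
    proof -
      have "adj v u" using that(3) by (simp add: insert_commute)
      then have "int (gdist u v) \<le> 1" "int (gdist v u) \<le> 1" using that(3) gdist_adj_le by auto
      then show ?thesis
        using P[of u v] P[of v u] far[OF that(1)] far[OF that(2)] adj_V[OF that(3)] by blast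
    qed
    then show ?thesis using successively_invariant[of adj xs P] xs by (auto simp: graph_path_def)
  qed
  have "\<forall>\<^sub>F n in sequentially. P (w (f n))"
    using P_w f by (rule eventually_subseq[rotated])
  \<comment> \<open>The common component contains a vertex with \<open>P\<close> and one
    without.\<close>
  then have "\<forall>\<^sub>F n in sequentially. w (f n) \<in> C \<and> r n \<in> C \<and> P (w (f n)) \<and> n > 0"
    using C(2,3) eventually_gt_at_top[of "0::nat"] by eventually_elim auto
  then obtain n where "w (f n) \<in> C" "r n \<in> C" "P (w (f n))" "n > 0"
    by (auto simp: eventually_sequentially)
  then show False using invariant[of "w (f n)"] invariant[of "r n"] P_r by auto
qed


end
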